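(* Let $G$ be a graph embedding with at least two edges, and let $D\subseteq E(G)$. Then the partial dual $G^D$ is closed $2$-cell if and only if all of the following conditions hold. (LC) For every bad vertex/face pair $(v,f)$ in $G$, at least one of $v$ or $f$ is mixed (or, equivalently, $\delta_G v\cup\partial_G f$ contains both a primal and a dual edge). (MC) For every exposed primal-pure (respectively dual-pure) vertex $v$ of $G$, every boundary walk of a totally primal (respectively totally dual) region passes through a corner at $v$ at most once. Also, for every exposed dual-pure (respectively primal-pure) face $f$ of $G$, every boundary walk of a totally primal (respectively totally dual) region passes through a corner of $f$ at most once. (GC) The embedding $Z^\times$, the Petrie dual of the primal/dual separation graph $Z$ of $G$, has no two faces that share two or more edges. Also, for each $0$-pure corner, with associated vertex $v'_i$ and face $f'_j$ in $G^D$, the faces of $Z^\times$ associated with $v'_i$ and $f'_j$ do not share an edge in $Z^\times$. Nor is there another $0$-pure corner that is associated with the same $v'_i$ and $f'_j$ in $G^D$.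
   Context: General conventions. Graphs are finite and may have loops and multiple edges. A surface is a connected compact $2$-manifold without boundary. $G$ denotes a connected graph $2$-cell embedded (every face an open disk) in a surface $\Sigma$, with vertex, edge and face sets $V(G),E(G),F(G)$. A $2$-cell embedding is closed $2$-cell if the boundary walk of every face is a cycle in the graph. A vertex/face pair $(v,f)$ is bad if $v$ and $f$ are incident more than once, and good otherwise. $\delta_G v$ is the set of edges incident with $v$ (including loops), and $\partial_G f$ is the set of edges on the boundary of $f$. Corners and corner graph. In each face $f$ place a point $u_f$. The radial graph has vertex set $V(G)\cup\{u_f: f\in F(G)\}$ and one edge joining $v$ to $u_f$, drawn inside $f$, for each incidence of $v$ with $f$ (each occurrence of $v$ in the boundary walk of $f$). A corner $y$ is the midpoint of an edge of the radial graph; it has an associated vertex $\nu(y)=v$, face $\phi(y)=f$, and an unordered pair of (possibly equal) edges $\varepsilon_G(y)=\{e,e'\}$, the two consecutive edges at $v$ between which it lies. The corner graph $K$ is the embedded graph in $\Sigma$ whose vertices are the corners, with a cycle $C_v$ of length $\deg(v)$ around each $v\in V(G)$ through the corners at $v$ in order, and a cycle $A_f$ of length $\deg(f)$ inside each face $f$ through the corners of $f$ in order. Its faces are: $c_v\ni v$ bounded by $C_v$; $a_f\subseteq f$ bounded by $A_f$; and for each $e\in E(G)$ a face $q_e$ of degree $4$ (a neighbourhood of the middle of $e$) bounded by a closed trail $Q_e$ of length $4$ alternating between edges crossing $e$ (belonging to cycles $C_v$) and edges parallel to $e$ (belonging to cycles $A_f$). Around a corner $y$ with $\nu(y)=v$,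 $\phi(y)=f$ and $\varepsilon_G(y)=\{e,e'\}$ the faces are $c_v,q_e,a_f,q_{e'}$ in that order. The closures of the faces of $K$ form a band decomposition of $G$ (vertices, edges, faces of $G$ corresponding to $\overline{c_v},\overline{q_e},\overline{a_f}$). Partial dual. Let $P=E(G)-D$; edges in $D$ are dual, edges in $P$ are primal. Let $\Delta$ be the union of all $\overline{c_v}$, $v\in V(G)$, and all $\overline{q_e}$, $e\in D$; its boundary is a disjoint union of simple closed curves $C'_1,\dots,C'_k$, which are cycles of $K$. Let $\Pi$ be the union of all $\overline{c_v}$ and all $\overline{q_e}$, $e\in P$; its boundary is a disjoint union of cycles $A'_1,\dots,A'_\ell$ of $K$. Remove all $c_v$ and $a_f$ from $\Sigma$, and glue on open disks $c'_i$ with $\partial c'_i=C'_i$ and $a'_j$ with $\partial a'_j=A'_j$. The result is a band decomposition of the partial dual $G^D$: its vertices $v'_i$, edges $e$ and faces $f'_j$ correspond to $\overline{c'_i}$, $\overline{q_e}$ and $\overline{a'_j}$. Incidences of $v'_i$ with $f'_j$ correspond to vertices (corners) common to $C'_i$ and $A'_j$. Each corner $y$ lies on exactly one $C'_i$ and exactly one $A'_j$; these give the vertex $v'_i$ and face $f'_j$ associated with $y$ in $G^D$. Pure/mixed. A vertex or face of $G$ is primal-pure if all its incident edges are in $P$, dual-pure if all are in $D$, pure in either case, and mixed otherwise. A corner $y$ with $\varepsilon_G(y)=\{e,e'\}$ is primal-pure if $e,e'\in P$, dual-pure if $e,e'\in D$, pure in either case, and mixed otherwise. A pure corner is $k$-pure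 ($k=0,1,2$) if exactly $k$ of $\nu(y)$, $\phi(y)$ are pure. A pure vertex of $G$ is exposed if it has more than one incidence with mixed faces of $G$ (more than one corner at it is $1$-pure); a pure face is exposed if it has more than one incidence with mixed vertices of $G$ (more than one corner of it is $1$-pure). Totally dual/primal regions. $T_D\subseteq\Sigma$ is the union of all edges in $D$ (with their ends) and all dual-pure faces; its components are the totally dual regions. $T_P$ is the union of all edges in $P$ (with their ends) and all primal-pure faces; its components are the totally primal regions. Each $C'_i$ is exactly one of: $C_v$ for some primal-pure vertex $v$; $A_f$ for some dual-pure face $f$; or neither, in which case (projected to $G$) it is a closed walk bounding a totally dual region from the outside. The cycles $C'_i$ of the last kind are meant by the boundary walks of totally dual regions. Similarly each $A'_j$ is $A_f$ for a primal-pure face $f$, or $C_v$ for a dual-pure vertex $v$, or neither; the cycles $A'_j$ of the last kind are meant by the boundary walks of totally primal regions. Such a walk passes through a corner $y$ if $y$ is a vertex of the cycle $C'_i$ (or $A'_j$) of $K$; "passes through a corner at $v$ (of $f$) at most once" means that the cycle contains at most one corner $y$ with $\nu(y)=v$ (with $\phi(y)=f$). Separation graph. The primal/dual separation graph $Z$ is the embedded subgraph of the radial graph induced by the edges whose midpoint is a mixed corner. Thus edges of $Z$ correspond to mixed corners, and vertices of $Z$ are mixed vertices $v$ of $G$ and points $u_f$ for mixed faces $f$. ($Z$ may be disconnected or not $2$-cell embedded.) Petrie dual. The Petrie dual $Z^\times$ has the same underlying graph as $Z$, and its faces are disks glued along the Petrie walks of $Z$: closed walks obtained by the face-tracing procedure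 in which one stays to one side of an edge while moving along it but crosses to its other side at the midpoint of each edge (so one turns alternately left and right with respect to a local orientation), continuing until the walk repeats; each edge is covered exactly twice in total by these closed walks. Faces of $Z^\times$ associated with vertices/faces of $G^D$. If $C'_i$ is a boundary walk of a totally dual region, its mixed corners divide it into segments that alternately lie in $A_f$ for a single face $f$ and in $C_v$ for a single vertex $v$; replacing each such segment by a passage through $u_f$, respectively $v$, turns $C'_i$ into the closed walk in $Z$ whose successive edges correspond to the successive mixed corners on $C'_i$. This is a Petrie walk of $Z$, and the corresponding face of $Z^\times$ is the face associated with $v'_i$. The face of $Z^\times$ associated with $f'_j$, when $A'_j$ is a boundary walk of a totally primal region, is defined in the same way from $A'_j$. (For a $0$-pure corner, the cycles $C'_i$ and $A'_j$ through it are always of these kinds.) *)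

theory Defs
  imports Main
begin

section \<open>Graphs embedded in surfaces\<close>

text \<open>
  A 2-cell embedding of a graph with at least one edge in a (possibly nonorientable) closed surface
  is encoded by its flags.  An edge \<open>e\<close> has four flags, one for each choice of an end of \<open>e\<close> and a
  side of \<open>e\<close>.  The flag \<open>b\<close> is sent by \<open>along\<close> to the other end of the same edge on the same side,
  by \<open>across\<close> to the other side of the edge at the same end, and by \<open>turn\<close> to the flag that shares a
  corner with \<open>b\<close>.  Vertices, edges, faces and corners are orbits, and each of them is represented by
  its set of flags.  So \<open>y \<subseteq> v\<close> says that the corner \<open>y\<close> is at the vertex \<open>v\<close>, and a vertex or face
  is incident with an edge if the two sets meet.  Loops, multiple edges and faces of degree one are
  allowed.
\<close>

record 'a embedding =
  flags :: "'a set"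
  along :: "'a \<Rightarrow> 'a"
  turn :: "'a \<Rightarrow> 'a"
  across :: "'a \<Rightarrow> 'a"

definition flag_orbit :: "'a set \<Rightarrow> ('a \<Rightarrow> 'a) set \<Rightarrow> 'a \<Rightarrow> 'a set" where
  "flag_orbit B H b = {c. (b, c) \<in> {(x, h x) | x h. x \<in> B \<and> h \<in> H}\<^sup>*}"

definition free_involution_on :: "'a set \<Rightarrow> ('a \<Rightarrow> 'a) \<Rightarrow> bool" where
  "free_involution_on B h \<longleftrightarrow> (\<forall>b\<in>B. h b \<in> B \<and> h b \<noteq> b \<and> h (h b) = b)"

definition is_embedding :: "'a embedding \<Rightarrow> bool" where
  "is_embedding G \<longleftrightarrow>
     finite (flags G) \<and> flags G \<noteq> {} \<and>
     free_involution_on (flags G) (along G) \<and>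
     free_involution_on (flags G) (turn G) \<and>
     free_involution_on (flags G) (across G) \<and>
     (\<forall>b\<in>flags G. along G b \<noteq> across G b \<and> along G (across G b) = across G (along G b)) \<and>
     (\<forall>b\<in>flags G. flag_orbit (flags G) {along G, turn G, across G} b = flags G)"

definition vertex_of :: "'a embedding \<Rightarrow> 'a \<Rightarrow> 'a set" where
  "vertex_of G b = flag_orbit (flags G) {turn G, across G} b"

definition edge_of :: "'a embedding \<Rightarrow> 'a \<Rightarrow> 'a set" where
  "edge_of G b = flag_orbit (flags G) {along G, across G} b"

definition face_of :: "'a embedding \<Rightarrow> 'a \<Rightarrow> 'a set" where
  "face_of G b = flag_orbit (flags G) {along G, turn G} b"

definition vertices :: "'a embedding \<Rightarrow> 'a set set" where
  "vertices G = vertex_of G ` flags G"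

definition edges :: "'a embedding \<Rightarrow> 'a set set" where
  "edges G = edge_of G ` flags G"

definition faces :: "'a embedding \<Rightarrow> 'a set set" where
  "faces G = face_of G ` flags G"

definition corners :: "'a embedding \<Rightarrow> 'a set set" where
  "corners G = {{b, turn G b} | b. b \<in> flags G}"

text \<open>The associated vertex $\nu(y)$ and face $\phi(y)$ of a corner.\<close>

definition corner_vertex :: "'a embedding \<Rightarrow> 'a set \<Rightarrow> 'a set" where
  "corner_vertex G y = (THE v. v \<in> vertices G \<and> y \<subseteq> v)"

definition corner_face :: "'a embedding \<Rightarrow> 'a set \<Rightarrow> 'a set" where
  "corner_face G y = (THE f. f \<in> faces G \<and> y \<subseteq> f)"

text \<open>
  For a vertex, face or corner \<open>X\<close> this is $\delta_G X$, $\partial_G X$ or $\varepsilon_G(X)$,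
  respectively.
\<close>

definition incident_edges :: "'a embedding \<Rightarrow> 'a set \<Rightarrow> 'a set set" where
  "incident_edges G X = {e \<in> edges G. e \<inter> X \<noteq> {}}"

definition bad_pair :: "'a embedding \<Rightarrow> 'a set \<Rightarrow> 'a set \<Rightarrow> bool" where
  "bad_pair G v f \<longleftrightarrow> card {y \<in> corners G. corner_vertex G y = v \<and> corner_face G y = f} > 1"

text \<open>
  The boundary walk of the face containing the flag \<open>b\<close>, started at \<open>b\<close>: the flag in position \<open>i\<close>
  stands for the \<open>i\<close>-th vertex of the walk together with the edge by which the walk leaves it.
\<close>

definition face_walk :: "'a embedding \<Rightarrow> 'a \<Rightarrow> 'a list" where
  "face_walk G b =
     map (\<lambda>i. ((turn G \<circ> along G) ^^ i) b) [0..<LEAST n. 0 < n \<and> ((turn G \<circ> along G) ^^ n) b = b]"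

text \<open>
  A closed walk is a cycle if it repeats neither a vertex nor an edge.  (A loop is a cycle, and so is
  a pair of parallel edges, but not a walk going back and forth along one edge.)
\<close>

definition is_cycle_walk :: "'a embedding \<Rightarrow> 'a list \<Rightarrow> bool" where
  "is_cycle_walk G w \<longleftrightarrow> w \<noteq> [] \<and> distinct (map (vertex_of G) w) \<and> distinct (map (edge_of G) w)"

definition closed_2_cell :: "'a embedding \<Rightarrow> bool" where
  "closed_2_cell G \<longleftrightarrow> (\<forall>b\<in>flags G. is_cycle_walk G (face_walk G b))"


section \<open>The corner graph and the partial dual\<close>

text \<open>
  The vertices of the corner graph \<open>K\<close> are the corners.  Each flag \<open>b\<close> is an angle of \<open>K\<close>, namely the
  angle at the corner \<open>{b, turn G b}\<close> in the quadrilateral of the edge of \<open>b\<close>.  An edge of \<open>K\<close> lies on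
  exactly one quadrilateral, and is represented by the pair of flags at its two ends in that
  quadrilateral: \<open>{b, across G b}\<close> is the edge of \<open>C_v\<close> crossing the edge of \<open>b\<close>, and
  \<open>{b, along G b}\<close> is the edge of \<open>A_f\<close> parallel to the edge of \<open>b\<close>.  A cycle of \<open>K\<close> is represented by
  the set of all flags at its corners; in particular \<open>C_v\<close> is represented by \<open>v\<close> and \<open>A_f\<close> by \<open>f\<close>.
\<close>

datatype 'a corner_graph_face =
    Vertex_Disk "'a set"
  | Edge_Quad "'a set"
  | Face_Disk "'a set"

fun disk_boundary :: "'a embedding \<Rightarrow> 'a corner_graph_face \<Rightarrow> 'a set set" where
  "disk_boundary G (Vertex_Disk v) = {{b, across G b} | b. b \<in> v}"
| "disk_boundary G (Edge_Quad e) = {{b, across G b} | b. b \<in> e} \<union> {{b, along G b} | b. b \<in> e}"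
| "disk_boundary G (Face_Disk f) = {{b, along G b} | b. b \<in> f}"

text \<open>
  Every edge of \<open>K\<close> lies on the boundary of two different faces of \<open>K\<close>.  It is on the boundary of a
  union of closed faces iff exactly one of the two faces belongs to the union.
\<close>

definition region_boundary :: "'a embedding \<Rightarrow> 'a corner_graph_face set \<Rightarrow> 'a set set" where
  "region_boundary G R = {x. \<exists>!X. X \<in> R \<and> x \<in> disk_boundary G X}"

definition region_Delta :: "'a embedding \<Rightarrow> 'a set set \<Rightarrow> 'a corner_graph_face set" where
  "region_Delta G D = Vertex_Disk ` vertices G \<union> Edge_Quad ` D"

definition region_Pi :: "'a embedding \<Rightarrow> 'a set set \<Rightarrow> 'a corner_graph_face set" where
  "region_Pi G D = Vertex_Disk ` vertices G \<union> Edge_Quad ` (edges G - D)"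

definition opposite_end :: "'a set set \<Rightarrow> 'a \<Rightarrow> 'a" where
  "opposite_end S b = (THE c. c \<noteq> b \<and> {b, c} \<in> S)"

text \<open>
  The partial dual has the same quadrilaterals and corners as \<open>G\<close>, hence the same flags and the same
  \<open>turn\<close>.  Two sides of each quadrilateral lie on the boundary of $\Delta$ and so on the new vertex
  disks; the other two lie on the boundary of $\Pi$ and so on the new face disks.  The vertices of the
  partial dual are the orbits of tracing the boundary of $\Delta$, that is, its boundary
  cycles $C'_i$, and its faces are in the same way the boundary cycles $A'_j$ of $\Pi$.
\<close>

definition partial_dual :: "'a embedding \<Rightarrow> 'a set set \<Rightarrow> 'a embedding" where
  "partial_dual G D =
     \<lparr> flags = flags G,
       along = opposite_end (region_boundary G (region_Pi G D)),
       turn = turn G,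
       across = opposite_end (region_boundary G (region_Delta G D)) \<rparr>"


section \<open>Pure and mixed\<close>

text \<open>These notions apply to vertices, faces and corners \<open>X\<close> alike.\<close>

definition primal_pure :: "'a embedding \<Rightarrow> 'a set set \<Rightarrow> 'a set \<Rightarrow> bool" where
  "primal_pure G D X \<longleftrightarrow> incident_edges G X \<subseteq> edges G - D"

definition dual_pure :: "'a embedding \<Rightarrow> 'a set set \<Rightarrow> 'a set \<Rightarrow> bool" where
  "dual_pure G D X \<longleftrightarrow> incident_edges G X \<subseteq> D"

definition mixed :: "'a embedding \<Rightarrow> 'a set set \<Rightarrow> 'a set \<Rightarrow> bool" where
  "mixed G D X \<longleftrightarrow> \<not> primal_pure G D X \<and> \<not> dual_pure G D X"

definition zero_pure_corner :: "'a embedding \<Rightarrow> 'a set set \<Rightarrow> 'a set \<Rightarrow> bool" where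
  "zero_pure_corner G D y \<longleftrightarrow>
     y \<in> corners G \<and> \<not> mixed G D y \<and>
     mixed G D (corner_vertex G y) \<and> mixed G D (corner_face G y)"

definition exposed_vertex :: "'a embedding \<Rightarrow> 'a set set \<Rightarrow> 'a set \<Rightarrow> bool" where
  "exposed_vertex G D v \<longleftrightarrow>
     v \<in> vertices G \<and> \<not> mixed G D v \<and>
     card {y \<in> corners G. corner_vertex G y = v \<and> mixed G D (corner_face G y)} > 1"

definition exposed_face :: "'a embedding \<Rightarrow> 'a set set \<Rightarrow> 'a set \<Rightarrow> bool" where
  "exposed_face G D f \<longleftrightarrow>
     f \<in> faces G \<and> \<not> mixed G D f \<and>
     card {y \<in> corners G. corner_face G y = f \<and> mixed G D (corner_vertex G y)} > 1"

text \<open>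
  The boundary walks of totally dual regions are the cycles $C'_i$ that are neither \<open>C_v\<close> for a
  primal-pure vertex \<open>v\<close> nor \<open>A_f\<close> for a dual-pure face \<open>f\<close>; dually for totally primal regions.
\<close>

definition dual_region_walks :: "'a embedding \<Rightarrow> 'a set set \<Rightarrow> 'a set set" where
  "dual_region_walks G D =
     vertices (partial_dual G D)
       - {v \<in> vertices G. primal_pure G D v} - {f \<in> faces G. dual_pure G D f}"

definition primal_region_walks :: "'a embedding \<Rightarrow> 'a set set \<Rightarrow> 'a set set" where
  "primal_region_walks G D =
     faces (partial_dual G D)
       - {f \<in> faces G. primal_pure G D f} - {v \<in> vertices G. dual_pure G D v}"

definition passes_at_vertex_once :: "'a embedding \<Rightarrow> 'a set \<Rightarrow> 'a set \<Rightarrow> bool" where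
  "passes_at_vertex_once G W v \<longleftrightarrow> card {y \<in> corners G. y \<subseteq> W \<and> corner_vertex G y = v} \<le> 1"

definition passes_at_face_once :: "'a embedding \<Rightarrow> 'a set \<Rightarrow> 'a set \<Rightarrow> bool" where
  "passes_at_face_once G W f \<longleftrightarrow> card {y \<in> corners G. y \<subseteq> W \<and> corner_face G y = f} \<le> 1"


section \<open>The separation graph and its Petrie dual\<close>

text \<open>
  The edge of the radial graph through the corner \<open>{b, turn G b}\<close> has the ends $\nu(y)$ and $u_f$ with
  $f = \phi(y)$, and its two sides are those of the flags \<open>b\<close> and \<open>turn G b\<close>.  So the flags of the
  separation graph \<open>Z\<close> are pairs of a flag \<open>b\<close> at a mixed corner (the side) and an end.
\<close>

datatype radial_end = At_Vertex | At_Face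

fun other_end :: "radial_end \<Rightarrow> radial_end" where
  "other_end At_Vertex = At_Face"
| "other_end At_Face = At_Vertex"

text \<open>
  Rotation around a vertex (\<open>step = across G\<close>) or inside a face (\<open>step = along G\<close>), starting from the
  side \<open>b\<close> of a corner, until the next mixed corner is met.
\<close>

definition next_mixed :: "'a embedding \<Rightarrow> 'a set set \<Rightarrow> ('a \<Rightarrow> 'a) \<Rightarrow> 'a \<Rightarrow> 'a" where
  "next_mixed G D step b =
     (let c = (\<lambda>n. ((step \<circ> turn G) ^^ n) (step b))
      in c (LEAST n. mixed G D {c n, turn G (c n)}))"

text \<open>
  \<open>Z\<close> inherits its rotation from the surface.  It may be disconnected, or not 2-cell embedded, so it
  need not satisfy \<open>is_embedding\<close> and the orbits \<open>faces\<close> of \<open>Z\<close> need not be its faces in the surface.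
  Its Petrie walks only depend on the data recorded here.
\<close>

definition separation_graph :: "'a embedding \<Rightarrow> 'a set set \<Rightarrow> ('a \<times> radial_end) embedding" where
  "separation_graph G D =
     \<lparr> flags = {(b, s) | b s. b \<in> flags G \<and> mixed G D {b, turn G b}},
       along = (\<lambda>(b, s). (b, other_end s)),
       turn = (\<lambda>(b, s).
         (next_mixed G D (case s of At_Vertex \<Rightarrow> across G | At_Face \<Rightarrow> along G) b, s)),
       across = (\<lambda>(b, s). (turn G b, s)) \<rparr>"

text \<open>
  Face tracing in which one crosses to the other side in the middle of each edge.
\<close>

definition petrie_dual :: "'a embedding \<Rightarrow> 'a embedding" where
  "petrie_dual M = M\<lparr>along := across M \<circ> along M\<rparr>"

text \<open>
  Let \<open>W\<close> be a cycle $C'_i$ or $A'_j$, and let \<open>step\<close> be the map taking a flag of \<open>W\<close> to the other end of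
  the edge of \<open>W\<close> that starts there.  A segment of \<open>W\<close> leaving a mixed corner by the flag \<open>b\<close> lies in
  \<open>C_v\<close> if its first edge is \<open>{b, across G b}\<close>, and in \<open>A_f\<close> if it is \<open>{b, along G b}\<close>; it is replaced by a
  passage through \<open>v\<close> or $u_f$, respectively.  The following flags of \<open>Z\<close> are the two ends of
  all these passages.
\<close>

definition passage_flags ::
  "'a embedding \<Rightarrow> 'a set set \<Rightarrow> ('a \<Rightarrow> 'a) \<Rightarrow> 'a set \<Rightarrow> ('a \<times> radial_end) set" where
  "passage_flags G D step W =
     {(b, At_Vertex) | b. b \<in> W \<and> mixed G D {b, turn G b} \<and> step b = across G b} \<union>
     {(b, At_Face) | b. b \<in> W \<and> mixed G D {b, turn G b} \<and> step b = along G b}"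

definition petrie_face_of_vertex ::
  "'a embedding \<Rightarrow> 'a set set \<Rightarrow> 'a set \<Rightarrow> ('a \<times> radial_end) set" where
  "petrie_face_of_vertex G D v' =
     (THE F. F \<in> faces (petrie_dual (separation_graph G D)) \<and>
        passage_flags G D (across (partial_dual G D)) v' \<subseteq> F)"

definition petrie_face_of_face ::
  "'a embedding \<Rightarrow> 'a set set \<Rightarrow> 'a set \<Rightarrow> ('a \<times> radial_end) set" where
  "petrie_face_of_face G D f' =
     (THE F. F \<in> faces (petrie_dual (separation_graph G D)) \<and>
        passage_flags G D (along (partial_dual G D)) f' \<subseteq> F)"

definition shared_edges :: "'a embedding \<Rightarrow> 'a set \<Rightarrow> 'a set \<Rightarrow> 'a set set" where
  "shared_edges M F1 F2 = incident_edges M F1 \<inter> incident_edges M F2"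


section \<open>The three conditions\<close>

definition LC :: "'a embedding \<Rightarrow> 'a set set \<Rightarrow> bool" where
  "LC G D \<longleftrightarrow>
     (\<forall>v\<in>vertices G. \<forall>f\<in>faces G. bad_pair G v f \<longrightarrow> mixed G D v \<or> mixed G D f)"

definition MC :: "'a embedding \<Rightarrow> 'a set set \<Rightarrow> bool" where
  "MC G D \<longleftrightarrow>
     (\<forall>v. exposed_vertex G D v \<longrightarrow>
        (primal_pure G D v \<longrightarrow> (\<forall>W\<in>primal_region_walks G D. passes_at_vertex_once G W v)) \<and>
        (dual_pure G D v \<longrightarrow> (\<forall>W\<in>dual_region_walks G D. passes_at_vertex_once G W v))) \<and>
     (\<forall>f. exposed_face G D f \<longrightarrow>
        (dual_pure G D f \<longrightarrow> (\<forall>W\<in>primal_region_walks G D. passes_at_face_once G W f)) \<and>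
        (primal_pure G D f \<longrightarrow> (\<forall>W\<in>dual_region_walks G D. passes_at_face_once G W f)))"

definition GC :: "'a embedding \<Rightarrow> 'a set set \<Rightarrow> bool" where
  "GC G D \<longleftrightarrow>
     (let Zx = petrie_dual (separation_graph G D); H = partial_dual G D in
       (\<forall>F1\<in>faces Zx. \<forall>F2\<in>faces Zx. F1 \<noteq> F2 \<longrightarrow> \<not> card (shared_edges Zx F1 F2) \<ge> 2) \<and>
       (\<forall>y. zero_pure_corner G D y \<longrightarrow>
          shared_edges Zx (petrie_face_of_vertex G D (corner_vertex H y))
                          (petrie_face_of_face G D (corner_face H y)) = {} \<and>
          \<not> (\<exists>y'. zero_pure_corner G D y' \<and> y' \<noteq> y \<and>
                corner_vertex H y' = corner_vertex H y \<and> corner_face H y' = corner_face H y)))"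

end

theory Submission
  imports Defs
begin

text \<open>
  On flags, the partial dual exchanges \<open>along\<close> and \<open>across\<close> at the flags of the edges in \<open>D\<close>.  A face
  walk of the partial dual is a cycle iff it has at most one corner at each vertex (a repeated edge
  forces a repeated vertex, unless the graph has a single edge).  So the partial dual is closed
  2-cell iff no two corners have the same vertex \<open>v'\<close> and the same face \<open>f'\<close> there.  Call an orbit
  bicoloured if it has flags of primal and of dual edges.  An orbit of the partial dual that is not
  bicoloured is an orbit of \<open>G\<close>, and the bicoloured ones are the boundary walks of the totally dual
  (primal) regions.  They are also the faces of the Petrie dual of the separation graph, whose edge
  through a corner lies on exactly the two faces given by the vertex and the face of the partial
  dual at that corner.  Pairs \<open>(v', f')\<close> with two common corners are excluded by (LC), (MC) or (GC)
  according to whether none, one or both of \<open>v'\<close> and \<open>f'\<close> are bicoloured.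
\<close>

section \<open>Orbits of flags\<close>

text \<open>\<open>along\<close> and \<open>across\<close> stay within an edge, so colour can change
  only by \<open>turn\<close> at a mixed corner. Hence an orbit of the partial dual follows one
  vertex or one face of \<open>G\<close> until it turns at such a corner, where it passes from the
  vertex to the face or back. This switch is the twist of the Petrie dual: moving along an edge of
  the separation graph changes end and side together. All conditions are brought to one form, a
  statement about flags \<open>b\<close>, \<open>c\<close> of different corners with a common vertex
  and a common face in the partial dual. With one bicoloured orbit, the four clauses of (MC) come
  from the colour of \<open>b\<close> and from which orbit is bicoloured. With two, the clauses of
  (GC) come from the number of mixed corners: two give two shared edges, one gives a 0-pure corner
  and a shared edge, none gives two 0-pure corners. A single edge is exceptional because the sphere
  with one edge joining two vertices has a face walk that repeats its edge but no vertex.\<close>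

lemma flag_orbit_self [simp]: "b \<in> flag_orbit B H b"
  by (simp add: flag_orbit_def)

lemma flag_orbit_step:
  assumes "c \<in> flag_orbit B H b" "c \<in> B" "h \<in> H"
  shows "h c \<in> flag_orbit B H b"
proof -
  have "(c, h c) \<in> {(x, h x) | x h. x \<in> B \<and> h \<in> H}"
    using assms by blast
  then show ?thesis
    using assms(1) by (auto simp: flag_orbit_def intro: rtrancl_into_rtrancl)
qed

lemma flag_orbit_subset:
  assumes "b \<in> S" and "\<And>c h. c \<in> S \<Longrightarrow> c \<in> B \<Longrightarrow> h \<in> H \<Longrightarrow> h c \<in> S"
  shows "flag_orbit B H b \<subseteq> S"
proof
  fix c assume "c \<in> flag_orbit B H b"
  then have "(b, c) \<in> {(x, h x) | x h. x \<in> B \<and> h \<in> H}\<^sup>*"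
    by (simp add: flag_orbit_def)
  then show "c \<in> S"
    by (induction rule: rtrancl_induct) (use assms in auto)
qed

lemma flag_orbit_in_flags:
  assumes "\<forall>h\<in>H. free_involution_on B h" "b \<in> B"
  shows "flag_orbit B H b \<subseteq> B"
  by (rule flag_orbit_subset) (use assms in \<open>auto simp: free_involution_on_def\<close>)

text \<open>Orbits are defined by forward reachability. Every generator undoes itself on
  \<open>B\<close>, so the step relation is symmetric and reachability is an equivalence.\<close>

lemma flag_orbit_eq:
  assumes "\<forall>h\<in>H. free_involution_on B h" "c \<in> flag_orbit B H b"
  shows "flag_orbit B H c = flag_orbit B H b"
proof -
  let ?r = "{(x, h x) | x h. x \<in> B \<and> h \<in> H}"
  have "sym ?r"
  proof (rule symI)
    fix x y assume "(x, y) \<in> ?r"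
    then obtain h where h: "y = h x" "x \<in> B" "h \<in> H" by blast
    then have "x = h y" "y \<in> B"
      using assms(1) by (auto simp: free_involution_on_def)
    then show "(y, x) \<in> ?r" using h(3) by blast
  qed
  then have "sym (?r\<^sup>*)" by (rule sym_rtrancl)
  moreover have "(b, c) \<in> ?r\<^sup>*" using assms(2) by (simp add: flag_orbit_def)
  ultimately show ?thesis
    unfolding flag_orbit_def by (blast dest: symD intro: rtrancl_trans)
qed

lemma flag_orbit_eq_iff:
  assumes "\<forall>h\<in>H. free_involution_on B h"
  shows "flag_orbit B H c = flag_orbit B H b \<longleftrightarrow> c \<in> flag_orbit B H b"
  using flag_orbit_eq[OF assms] flag_orbit_self[of c B H] by blast

text \<open>Agreement is assumed on the orbit under \<open>h\<close> only. The orbit under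
  \<open>k\<close> is shown to stay inside it, which gives agreement there too and hence the other
  inclusion.\<close>

lemma flag_orbit_cong_on:
  assumes "\<And>c. c \<in> flag_orbit B {t, h} b \<Longrightarrow> c \<in> B \<Longrightarrow> k c = h c"
  shows "flag_orbit B {t, k} b = flag_orbit B {t, h} b"
proof
  show sub: "flag_orbit B {t, k} b \<subseteq> flag_orbit B {t, h} b"
    by (rule flag_orbit_subset) (use assms in \<open>auto intro: flag_orbit_step\<close>)
  show "flag_orbit B {t, h} b \<subseteq> flag_orbit B {t, k} b"
  proof (rule flag_orbit_subset)
    fix c g assume c: "c \<in> flag_orbit B {t, k} b" "c \<in> B" "g \<in> {t, h}"
    then have "k c = h c" using sub assms by blast
    then show "g c \<in> flag_orbit B {t, k} b"
      using c flag_orbit_step[of c B "{t, k}" b t] flag_orbit_step[of c B "{t, k}" b k] by auto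
  qed simp
qed

section \<open>Orbits of two involutions: the dihedral action\<close>

locale involution_pair =
  fixes B :: "'b set" and t h :: "'b \<Rightarrow> 'b"
  assumes finite_B: "finite B"
    and t_inv: "free_involution_on B t"
    and h_inv: "free_involution_on B h"
begin

text \<open>Powers of the rotation in the dihedral group generated by the two involutions. For
  \<open>turn\<close> and \<open>along\<close> the rotation is the successor map of
  \<open>face_walk\<close>.\<close>

definition rot :: "nat \<Rightarrow> 'b \<Rightarrow> 'b" where
  "rot n = (t \<circ> h) ^^ n"

lemma rot_simps [simp]: "rot 0 b = b" "rot (Suc n) b = t (h (rot n b))"
  by (simp_all add: rot_def)

lemma rot_add: "rot (m + n) b = rot m (rot n b)"
  by (simp add: rot_def funpow_add)

lemma t_simps [simp]: "b \<in> B \<Longrightarrow> t b \<in> B" "b \<in> B \<Longrightarrow> t b \<noteq> b" "b \<in> B \<Longrightarrow> t (t b) = b"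
  and h_simps [simp]: "b \<in> B \<Longrightarrow> h b \<in> B" "b \<in> B \<Longrightarrow> h b \<noteq> b" "b \<in> B \<Longrightarrow> h (h b) = b"
  using t_inv h_inv by (auto simp: free_involution_on_def)

lemma rot_in [simp]: "b \<in> B \<Longrightarrow> rot n b \<in> B"
  by (induction n) auto

lemma rot_cancel:
  assumes "b \<in> B" "rot (i + k) b = rot i b"
  shows "rot k b = b"
  using assms(2)
proof (induction i)
  case (Suc i)
  then have "t (h (rot (i + k) b)) = t (h (rot i b))" by simp
  then have "h (rot (i + k) b) = h (rot i b)"
    using assms(1) by (metis rot_in h_simps(1) t_simps(3))
  then have "rot (i + k) b = rot i b"
    using assms(1) by (metis rot_in h_simps(3))
  then show ?case by (rule Suc.IH)
qed simp

lemma period_exists: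
  assumes "b \<in> B"
  obtains n where "0 < n" "rot n b = b"
proof -
  have "finite (range (\<lambda>n. rot n b))"
    by (rule finite_subset[OF _ finite_B]) (use assms rot_in in auto)
  then have "\<not> inj (\<lambda>n. rot n b)"
    using finite_imageD infinite_UNIV_nat by blast
  then obtain i j where "i < j" "rot i b = rot j b"
    by (metis (mono_tags, lifting) injI linorder_neqE_nat)
  then have "rot (j - i) b = b"
    using rot_cancel[of b i "j - i"] assms by simp
  then show thesis using that[of "j - i"] \<open>i < j\<close> by simp
qed

text \<open>Cancelling one step at each end of the equation shortens it by two rotations and moves
  the base flag to \<open>t (h b)\<close>. In the end \<open>t\<close> or \<open>h\<close> itself
  would fix a flag.\<close>

lemma rot_ne_t: "b \<in> B \<Longrightarrow> rot m b \<noteq> t b"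
proof (induction m arbitrary: b rule: less_induct)
  case (less m)
  consider "m = 0" | "m = 1" | k where "m = Suc (Suc k)"
    by (metis One_nat_def not0_implies_Suc)
  then show ?case
  proof cases
    case 1
    then show ?thesis using less.prems by (metis rot_simps(1) t_simps(2))
  next
    case 2
    then show ?thesis using less.prems by simp (metis h_simps(1,2) t_simps(3))
  next
    case 3
    let ?c = "t (h b)"
    have c: "?c \<in> B" "t ?c = h b" using less.prems by auto
    show ?thesis
    proof
      assume *: "rot m b = t b"
      have "rot m b = t (h (rot k ?c))"
        using 3 rot_add[of k 1 b] by simp
      then have "t (h (rot k ?c)) = t b" using * by simp
      then have "h (rot k ?c) = b"
        using c less.prems by (metis rot_in h_simps(1) t_simps(3))
      then have "rot k ?c = t ?c"
        using c less.prems by (metis rot_in h_simps(3))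
      then show False using less.IH[of k ?c] c 3 by simp
    qed
  qed
qed

lemma rot_ne_t_rot: "b \<in> B \<Longrightarrow> rot j b \<noteq> t (rot i b)"
proof (induction i arbitrary: j)
  case 0
  then show ?case using rot_ne_t by simp
next
  case (Suc i)
  show ?case
  proof
    assume "rot j b = t (rot (Suc i) b)"
    then have "rot j b = h (rot i b)" using Suc.prems by simp
    then have "rot (Suc j) b = t (rot i b)" using Suc.prems by simp
    then show False using Suc.IH[OF Suc.prems] by blast
  qed
qed

lemma dihedral_orbit:
  assumes "b \<in> B"
  shows "flag_orbit B {t, h} b = {c. \<exists>k. c = rot k b \<or> c = t (rot k b)}" (is "_ = ?S")
proof
  show "flag_orbit B {t, h} b \<subseteq> ?S"
  proof (rule flag_orbit_subset)
    show "b \<in> ?S" by (auto intro: exI[of _ 0])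
    fix c g assume c: "c \<in> ?S" "c \<in> B" "g \<in> {t, h}"
    then obtain k where k: "c = rot k b \<or> c = t (rot k b)" by blast
    have "t c \<in> ?S" using k assms by auto
    moreover have "h c \<in> ?S" using k
    proof
      assume "c = rot k b"
      then have "h c = t (rot (Suc k) b)" using assms by simp
      then show ?thesis by blast
    next
      assume ck: "c = t (rot k b)"
      \<comment> \<open>Applying \<open>h\<close> to \<open>t (rot k b)\<close> undoes a rotation.
        Adding a full period makes the exponent positive, so this is a smaller power even for
        \<open>k = 0\<close>.\<close>
      obtain n where n: "0 < n" "rot n b = b" using period_exists[OF assms] .
      have "rot (k + n) b = rot k b" using n by (simp add: rot_add)
      moreover obtain l where "k + n = Suc l" using n(1) by (metis add_gr_0 gr0_conv_Suc)
      ultimately have "rot k b = t (h (rot l b))" by (metis rot_simps(2))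
      then have "h c = rot l b" using ck assms by simp
      then show ?thesis by blast
    qed
    ultimately show "g c \<in> ?S" using c(3) by blast
  qed
  have *: "rot k b \<in> flag_orbit B {t, h} b" for k
  proof (induction k)
    case (Suc k)
    have "h (rot k b) \<in> flag_orbit B {t, h} b"
      by (rule flag_orbit_step[OF Suc]) (use assms in auto)
    then have "t (h (rot k b)) \<in> flag_orbit B {t, h} b"
      by (rule flag_orbit_step) (use assms in auto)
    then show ?case by simp
  qed simp
  then have "t (rot k b) \<in> flag_orbit B {t, h} b" for k
    by (rule flag_orbit_step) (use assms in auto)
  with * show "?S \<subseteq> flag_orbit B {t, h} b" by blast
qed

end

section \<open>Corners and cycles\<close>

text \<open>This part of \<open>is_embedding\<close> is inherited by the partial dual, so the lemmas
  of the locale are available for \<open>G\<close> and for \<open>H\<close> alike.\<close>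

locale flag_system =
  fixes G :: "'a embedding"
  assumes finite_flags: "finite (flags G)"
    and along_inv: "free_involution_on (flags G) (along G)"
    and turn_inv: "free_involution_on (flags G) (turn G)"
    and across_inv: "free_involution_on (flags G) (across G)"
    and along_ne_across: "b \<in> flags G \<Longrightarrow> along G b \<noteq> across G b"
    and along_across: "b \<in> flags G \<Longrightarrow> along G (across G b) = across G (along G b)"

lemma is_embedding_flag_system: "is_embedding G \<Longrightarrow> flag_system G"
  unfolding is_embedding_def flag_system_def by blast

context flag_system
begin

sublocale f: involution_pair "flags G" "turn G" "along G"
  by unfold_locales (fact finite_flags turn_inv along_inv)+

sublocale v: involution_pair "flags G" "turn G" "across G"
  by unfold_locales (fact finite_flags turn_inv across_inv)+

lemma face_of_turn_along: "face_of G b = flag_orbit (flags G) {turn G, along G} b"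
  by (simp add: face_of_def insert_commute)

lemma mem_own_orbit [simp]: "b \<in> vertex_of G b" "b \<in> face_of G b" "b \<in> edge_of G b"
  by (simp_all add: vertex_of_def face_of_def edge_of_def)

lemma orbit_eq_iff:
  "vertex_of G c = vertex_of G b \<longleftrightarrow> c \<in> vertex_of G b"
  "face_of G c = face_of G b \<longleftrightarrow> c \<in> face_of G b"
  "edge_of G c = edge_of G b \<longleftrightarrow> c \<in> edge_of G b"
  unfolding vertex_of_def face_of_def edge_of_def
  by (rule flag_orbit_eq_iff, use turn_inv along_inv across_inv in simp)+

lemma orbit_subset_flags:
  assumes "b \<in> flags G"
  shows "vertex_of G b \<subseteq> flags G" "face_of G b \<subseteq> flags G" "edge_of G b \<subseteq> flags G"
  unfolding vertex_of_def face_of_def edge_of_def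
  using turn_inv along_inv across_inv assms by (simp_all add: flag_orbit_in_flags)

lemma orbit_invariant:
  assumes "b \<in> flags G"
  shows "vertex_of G (turn G b) = vertex_of G b" "vertex_of G (across G b) = vertex_of G b"
    "face_of G (turn G b) = face_of G b" "face_of G (along G b) = face_of G b"
    "edge_of G (along G b) = edge_of G b" "edge_of G (across G b) = edge_of G b"
  unfolding orbit_eq_iff unfolding vertex_of_def face_of_def edge_of_def
  using assms flag_orbit_step[OF flag_orbit_self, of b "flags G"] by simp_all

lemma edge_of_eq:
  assumes "b \<in> flags G"
  shows "edge_of G b = {b, along G b, across G b, along G (across G b)}"
proof
  show "edge_of G b \<subseteq> {b, along G b, across G b, along G (across G b)}"
    unfolding edge_of_def
    by (rule flag_orbit_subset) (use assms along_across in auto)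
  show "{b, along G b, across G b, along G (across G b)} \<subseteq> edge_of G b"
    using assms orbit_invariant(5,6) by (simp flip: orbit_eq_iff(3))
qed

section \<open>Corners represented by flags\<close>

lemma corner_vertex_eq:
  assumes "b \<in> flags G"
  shows "corner_vertex G {b, turn G b} = vertex_of G b"
  unfolding corner_vertex_def
proof (rule the_equality)
  show "vertex_of G b \<in> vertices G \<and> {b, turn G b} \<subseteq> vertex_of G b"
    using assms orbit_invariant by (auto simp: vertices_def simp flip: orbit_eq_iff)
  fix w assume "w \<in> vertices G \<and> {b, turn G b} \<subseteq> w"
  then obtain x where "w = vertex_of G x" "b \<in> vertex_of G x" by (auto simp: vertices_def)
  then show "w = vertex_of G b" using orbit_eq_iff(1)[of b x] by simp
qed

lemma corner_face_eq:
  assumes "b \<in> flags G"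
  shows "corner_face G {b, turn G b} = face_of G b"
  unfolding corner_face_def
proof (rule the_equality)
  show "face_of G b \<in> faces G \<and> {b, turn G b} \<subseteq> face_of G b"
    using assms orbit_invariant by (auto simp: faces_def simp flip: orbit_eq_iff)
  fix w assume "w \<in> faces G \<and> {b, turn G b} \<subseteq> w"
  then obtain x where "w = face_of G x" "b \<in> face_of G x" by (auto simp: faces_def)
  then show "w = face_of G b" using orbit_eq_iff(2)[of b x] by simp
qed

text \<open>A corner is represented by either of its two flags, so being at another corner means
  avoiding both \<open>b\<close> and \<open>turn G b\<close>.\<close>

definition distinct_corners :: "'a \<Rightarrow> 'a \<Rightarrow> bool" where
  "distinct_corners b c \<longleftrightarrow> b \<in> flags G \<and> c \<in> flags G \<and> c \<noteq> b \<and> c \<noteq> turn G b"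

lemma finite_corners: "finite (corners G)"
proof -
  have "corners G = (\<lambda>b. {b, turn G b}) ` flags G" by (auto simp: corners_def)
  then show ?thesis using finite_flags by simp
qed

lemma corner_eq_iff:
  "\<lbrakk>b \<in> flags G; c \<in> flags G\<rbrakk> \<Longrightarrow> {b, turn G b} = {c, turn G c} \<longleftrightarrow> \<not> distinct_corners b c"
  unfolding distinct_corners_def doubleton_eq_iff by (metis f.t_simps(3))

text \<open>Common form of bad pairs, exposure and the at-most-once conditions: each counts corners
  with a property \<open>P\<close>, and \<open>Q\<close> reads \<open>P\<close> off a single flag of
  the corner.\<close>

lemma card_corners_gt_1:
  assumes "\<And>b. b \<in> flags G \<Longrightarrow> P {b, turn G b} \<longleftrightarrow> Q b"
  shows "card {y \<in> corners G. P y} > 1 \<longleftrightarrow> (\<exists>b c. distinct_corners b c \<and> Q b \<and> Q c)"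
proof -
  have "card {y \<in> corners G. P y} > 1 \<longleftrightarrow>
      \<not> (\<forall>y1\<in>{y \<in> corners G. P y}. \<forall>y2\<in>{y \<in> corners G. P y}. y1 = y2)"
    using card_le_Suc0_iff_eq[of "{y \<in> corners G. P y}"] finite_corners by auto
  also have "\<dots> \<longleftrightarrow> (\<exists>b\<in>flags G. \<exists>c\<in>flags G. P {b, turn G b} \<and> P {c, turn G c} \<and>
      {b, turn G b} \<noteq> {c, turn G c})"
    by (auto simp: corners_def)
  also have "\<dots> \<longleftrightarrow> (\<exists>b c. distinct_corners b c \<and> Q b \<and> Q c)"
    using assms corner_eq_iff by (auto simp: distinct_corners_def)
  finally show ?thesis .
qed

text \<open>The walk uses one flag of each corner of the face, so a repeated vertex amounts to two
  corners of the face at that vertex. If no vertex is repeated, an edge can recur only on its other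
  side in the opposite direction, and then each of the two passages must be the successor of the
  other. Both ends of the edge then have degree one, which \<open>two_edges\<close>
  excludes.\<close>

lemma is_cycle_walk_face_walk_iff:
  assumes b: "b \<in> flags G"
    and two_edges: "\<And>c. c \<in> flags G \<Longrightarrow>
      \<not> (turn G c = across G c \<and> turn G (along G c) = across G (along G c))"
  shows "is_cycle_walk G (face_walk G b) \<longleftrightarrow>
    (\<forall>c\<in>face_of G b. \<forall>d\<in>face_of G b. distinct_corners c d \<longrightarrow> vertex_of G c \<noteq> vertex_of G d)"
proof -
  define n where "n = (LEAST n. 0 < n \<and> f.rot n b = b)"
  obtain n0 where "0 < n0 \<and> f.rot n0 b = b"
    using f.period_exists[OF b] unfolding f.rot_def by blast
  then have n: "0 < n" "f.rot n b = b" "\<And>m. 0 < m \<Longrightarrow> f.rot m b = b \<Longrightarrow> n \<le> m"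
    using LeastI[of "\<lambda>n. 0 < n \<and> f.rot n b = b" n0] unfolding n_def by (auto intro: Least_le)
  have walk: "face_walk G b = map (\<lambda>i. f.rot i b) [0..<n]"
    by (simp add: face_walk_def n_def f.rot_def)
  have in_f: "f.rot i b \<in> flags G" for i using b by simp
  have inj: "f.rot i b \<noteq> f.rot j b" if "i < j" "j < n" for i j
  proof
    assume "f.rot i b = f.rot j b"
    then have "f.rot (j - i) b = b"
      using f.rot_cancel[of b i "j - i"] b that by simp
    then show False using n(3)[of "j - i"] that by simp
  qed
  have mod_n: "f.rot i b = f.rot (i mod n) b" for i
  proof (induction i rule: less_induct)
    case (less i)
    show ?case
    proof (cases "i < n")
      case False
      then have "f.rot i b = f.rot (i - n) b"
        using f.rot_add[of "i - n" n b] n(2) by simp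
      then show ?thesis using less[of "i - n"] False n(1) by (simp add: le_mod_geq)
    qed simp
  qed
  have orbit: "face_of G b = {c. \<exists>i<n. c = f.rot i b \<or> c = turn G (f.rot i b)}"
    unfolding face_of_turn_along f.dihedral_orbit[OF b]
    using mod_n n(1) by (auto) (metis mod_less_divisor)+
  have distinct: "distinct (map g (face_walk G b)) \<longleftrightarrow>
      (\<forall>i j. i < j \<and> j < n \<longrightarrow> g (f.rot i b) \<noteq> g (f.rot j b))" for g :: "'a \<Rightarrow> 'a set"
    by (auto simp: walk distinct_conv_nth) (metis nat_neq_iff)
  have vertices: "distinct (map (vertex_of G) (face_walk G b)) \<longleftrightarrow>
    (\<forall>c\<in>face_of G b. \<forall>d\<in>face_of G b. distinct_corners c d \<longrightarrow> vertex_of G c \<noteq> vertex_of G d)"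
    (is "_ \<longleftrightarrow> ?R")
  proof
    assume L: "distinct (map (vertex_of G) (face_walk G b))"
    show ?R
    proof (intro ballI impI notI)
      fix c d assume cd: "c \<in> face_of G b" "d \<in> face_of G b" "distinct_corners c d"
        "vertex_of G c = vertex_of G d"
      obtain i j where ij: "i < n" "c = f.rot i b \<or> c = turn G (f.rot i b)"
        "j < n" "d = f.rot j b \<or> d = turn G (f.rot j b)"
        using cd(1,2) unfolding orbit by blast
      then have "i \<noteq> j" using cd(3) in_f by (auto simp: distinct_corners_def)
      moreover have "vertex_of G (f.rot i b) = vertex_of G (f.rot j b)"
        using ij cd(4) in_f orbit_invariant(1) by metis
      ultimately show False using L ij unfolding distinct by (metis nat_neq_iff)
    qed
  next
    assume R: ?R
    show "distinct (map (vertex_of G) (face_walk G b))"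
      unfolding distinct
    proof (intro allI impI)
      fix i j assume ij: "i < j \<and> j < n"
      then have "distinct_corners (f.rot i b) (f.rot j b)"
        using inj f.rot_ne_t_rot[OF b] in_f unfolding distinct_corners_def by metis
      moreover have "f.rot i b \<in> face_of G b" "f.rot j b \<in> face_of G b"
        unfolding orbit using ij less_trans by blast+
      ultimately show "vertex_of G (f.rot i b) \<noteq> vertex_of G (f.rot j b)" using R by blast
    qed
  qed
  have edges: "distinct (map (edge_of G) (face_walk G b))"
    if L: "distinct (map (vertex_of G) (face_walk G b))"
    unfolding distinct
  proof (intro allI impI notI)
    fix i j assume ij: "i < j \<and> j < n" and eq: "edge_of G (f.rot i b) = edge_of G (f.rot j b)"
    define c d where "c = f.rot i b" and "d = f.rot j b"
    have cd: "c \<in> flags G" "d \<in> flags G" by (simp_all add: c_def d_def in_f)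
    \<comment> \<open>Position \<open>Suc j\<close> may equal \<open>n\<close> and wrap around to
      the start, so indices are reduced modulo \<open>n\<close>.\<close>
    have nv: "vertex_of G (f.rot k b) = vertex_of G (f.rot l b) \<longleftrightarrow> f.rot k b = f.rot l b" for k l
    proof
      assume "vertex_of G (f.rot k b) = vertex_of G (f.rot l b)"
      then have *: "vertex_of G (f.rot (k mod n) b) = vertex_of G (f.rot (l mod n) b)"
        using mod_n by metis
      have "k mod n = l mod n"
      proof (rule ccontr)
        assume "k mod n \<noteq> l mod n"
        then consider "k mod n < l mod n" | "l mod n < k mod n" by linarith
        then show False
          using L n(1) * unfolding distinct by cases (metis mod_less_divisor)+
      qed
      then show "f.rot k b = f.rot l b" using mod_n by metis
    qed simp
    have "d \<in> edge_of G c"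
      using eq mem_own_orbit(3)[of d] by (simp add: c_def d_def)
    then consider "d = c" | "d = along G c" | "d = across G c" | "d = along G (across G c)"
      unfolding edge_of_eq[OF cd(1)] by blast
    then show False
    proof cases
      case 1
      then show ?thesis using inj[of i j] ij by (simp add: c_def d_def)
    next
      case 2
      \<comment> \<open>Same side in reverse: the walk would contain both flags of one
        corner.\<close>
      then have "turn G d = f.rot (Suc i) b" using c_def by simp
      then show ?thesis using f.rot_ne_t_rot[OF b, of "Suc i" j] d_def by simp
    next
      case 3
      then have "vertex_of G d = vertex_of G c" using orbit_invariant(2) cd by simp
      then show ?thesis using L ij unfolding distinct c_def d_def by fastforce
    next
      case 4
      \<comment> \<open>Other side, opposite direction: \<open>d\<close> starts at the vertex where
        the passage of \<open>c\<close> ends, and conversely.\<close>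
      have *: "across G c = along G d" "across G d = along G c"
        unfolding 4 using cd(1) by (simp_all add: along_across)
      have Suc: "f.rot (Suc i) b = turn G (along G c)" "f.rot (Suc j) b = turn G (along G d)"
        by (simp_all add: c_def d_def)
      have "vertex_of G (f.rot (Suc j) b) = vertex_of G c"
        unfolding Suc *(1)[symmetric] using cd by (simp add: orbit_invariant)
      then have j: "turn G (along G d) = c"
        using nv[of "Suc j" i] unfolding Suc c_def by blast
      have "vertex_of G (f.rot (Suc i) b) = vertex_of G d"
        unfolding Suc *(2)[symmetric] using cd by (simp add: orbit_invariant)
      then have i: "turn G (along G c) = d"
        using nv[of "Suc i" j] unfolding Suc d_def by blast
      have "turn G c = across G c" using f.t_simps(3)[of "along G d"] j *(1) cd by simp
      moreover have "turn G (along G c) = across G (along G c)" using i *(2)[symmetric] cd by simp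
      ultimately show ?thesis using two_edges cd by blast
    qed
  qed
  have "face_walk G b \<noteq> []" using n(1) by (simp add: walk)
  then show ?thesis
    using vertices edges unfolding is_cycle_walk_def by blast
qed

lemma closed_2_cell_iff:
  assumes "\<And>c. c \<in> flags G \<Longrightarrow>
      \<not> (turn G c = across G c \<and> turn G (along G c) = across G (along G c))"
  shows "closed_2_cell G \<longleftrightarrow>
    (\<forall>b c. distinct_corners b c \<longrightarrow> c \<in> vertex_of G b \<longrightarrow> c \<notin> face_of G b)"
proof -
  have "closed_2_cell G \<longleftrightarrow> (\<forall>b\<in>flags G. \<forall>c\<in>face_of G b. \<forall>d\<in>face_of G b.
      distinct_corners c d \<longrightarrow> vertex_of G c \<noteq> vertex_of G d)"
    unfolding closed_2_cell_def using is_cycle_walk_face_walk_iff assms by simp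
  also have "\<dots> \<longleftrightarrow> (\<forall>b c. distinct_corners b c \<longrightarrow> c \<in> vertex_of G b \<longrightarrow> c \<notin> face_of G b)"
  proof (intro iffI allI impI ballI notI)
    fix b c
    assume L: "\<forall>b\<in>flags G. \<forall>c\<in>face_of G b. \<forall>d\<in>face_of G b.
      distinct_corners c d \<longrightarrow> vertex_of G c \<noteq> vertex_of G d"
      and bc: "distinct_corners b c" "c \<in> vertex_of G b" "c \<in> face_of G b"
    then have "vertex_of G b \<noteq> vertex_of G c"
      using mem_own_orbit(2)[of b] by (auto simp: distinct_corners_def)
    then show False using bc(2) orbit_eq_iff(1)[of c b] by simp
  next
    fix b c d
    assume R: "\<forall>b c. distinct_corners b c \<longrightarrow> c \<in> vertex_of G b \<longrightarrow> c \<notin> face_of G b"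
      and bcd: "c \<in> face_of G b" "d \<in> face_of G b" "distinct_corners c d"
        "vertex_of G c = vertex_of G d"
    then have "d \<in> vertex_of G c" by simp
    moreover have "d \<in> face_of G c"
      using bcd(1,2) orbit_eq_iff(2)[of c b] by simp
    ultimately show False using R bcd(3) by blast
  qed
  finally show ?thesis .
qed

end

section \<open>The partial dual\<close>

locale partial_duality = flag_system +
  fixes D :: "'a set set"
  assumes D_edges: "D \<subseteq> edges G"
begin

section \<open>Colours of flags and the region boundaries\<close>

abbreviation H :: "'a embedding" where "H \<equiv> partial_dual G D"

definition dual_flag :: "'a \<Rightarrow> bool" where
  "dual_flag b \<longleftrightarrow> edge_of G b \<in> D"

text \<open>The flag version of \<open>mixed\<close>, used for orbits of \<open>G\<close> and of the
  partial dual alike.\<close>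

definition bicoloured :: "'a set \<Rightarrow> bool" where
  "bicoloured X \<longleftrightarrow> (\<exists>b\<in>X. dual_flag b) \<and> (\<exists>b\<in>X. \<not> dual_flag b)"

lemma edge_in_edges [simp]: "b \<in> flags G \<Longrightarrow> edge_of G b \<in> edges G"
  by (simp add: edges_def)

text \<open>The edge \<open>{b, across G b}\<close> of the corner graph lies on a vertex disk, which
  is in the region, and on the quadrilateral of its edge; so it is a boundary edge iff the
  quadrilateral is absent. The edge \<open>{b, along G b}\<close> lies on that quadrilateral and a
  face disk, which is not in the region; so it is a boundary edge iff the quadrilateral is present.
  Leaving \<open>E\<close> open covers both \<open>region_Delta\<close> and
  \<open>region_Pi\<close>.\<close>

lemma opposite_end_region_boundary:
  assumes b: "b \<in> flags G" and E: "E \<subseteq> edges G"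
  shows "opposite_end (region_boundary G (Vertex_Disk ` vertices G \<union> Edge_Quad ` E)) b =
    (if edge_of G b \<in> E then along G b else across G b)"
proof -
  let ?R = "Vertex_Disk ` vertices G \<union> Edge_Quad ` E"
  have vertex_flags: "c \<in> flags G" if "v \<in> vertices G" "c \<in> v" for v c
    using that orbit_subset_flags(1) by (auto simp: vertices_def)
  have edge_flags: "c \<in> flags G" if "e \<in> E" "c \<in> e" for e c
    using that E orbit_subset_flags(3) by (auto simp: edges_def)
  have edge: "e = edge_of G c" if "e \<in> E" "c \<in> e" for e c
  proof -
    have "e \<in> edges G" using E that(1) by blast
    then obtain d where "e = edge_of G d" by (auto simp: edges_def)
    then show ?thesis using that orbit_eq_iff(3)[of c d] by simp
  qed
  have vertex: "v = vertex_of G c" if v: "v \<in> vertices G" "c \<in> v" for v c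
  proof -
    obtain d where "v = vertex_of G d" using v(1) by (auto simp: vertices_def)
    then show ?thesis using v orbit_eq_iff(1)[of c d] by simp
  qed
  have across_pair: "c = b \<or> c = across G b" if "{b, d} = {c, across G c}" "c \<in> flags G" for c d
    using that v.h_simps(3)[of c] by (auto simp: doubleton_eq_iff)
  have along_pair: "c = b \<or> c = along G b" if "{b, d} = {c, along G c}" "c \<in> flags G" for c d
    using that f.h_simps(3)[of c] by (auto simp: doubleton_eq_iff)
  have quad: "X = Edge_Quad (edge_of G b)"
    if X: "X \<in> Edge_Quad ` E" "{b, d} \<in> disk_boundary G X" for X d
  proof -
    obtain e where e: "X = Edge_Quad e" "e \<in> E" using X(1) by blast
    then obtain c where c: "c \<in> e" "{b, d} = {c, across G c} \<or> {b, d} = {c, along G c}"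
      using X(2) by auto
    then have "edge_of G c = edge_of G b"
      using across_pair along_pair edge_flags[OF e(2)] orbit_invariant(5,6)[OF b] by metis
    then show ?thesis using edge[OF e(2) c(1)] e by simp
  qed
  have disk: "X = Vertex_Disk (vertex_of G b) \<and> d = across G b"
    if X: "X \<in> Vertex_Disk ` vertices G" "{b, d} \<in> disk_boundary G X" for X d
  proof -
    obtain v where v: "X = Vertex_Disk v" "v \<in> vertices G" using X(1) by blast
    then obtain c where c: "c \<in> v" "{b, d} = {c, across G c}"
      using X(2) by auto
    have cf: "c \<in> flags G" using vertex_flags v(2) c(1) .
    have "c = b \<or> c = across G b" using across_pair[OF c(2) cf] .
    then have "vertex_of G c = vertex_of G b"
      using orbit_invariant(2)[OF b] by metis
    moreover have "d = across G b"
      using c(2) cf v.h_simps(3)[of c] by (auto simp: doubleton_eq_iff)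
    ultimately show ?thesis using vertex[OF v(2) c(1)] v by simp
  qed
  have mem_disk: "Vertex_Disk (vertex_of G b) \<in> ?R"
    "{b, across G b} \<in> disk_boundary G (Vertex_Disk (vertex_of G b))"
    using b mem_own_orbit(1)[of b] by (auto simp: vertices_def)
  have mem_quad: "{b, across G b} \<in> disk_boundary G (Edge_Quad (edge_of G b))"
    "{b, along G b} \<in> disk_boundary G (Edge_Quad (edge_of G b))"
    using mem_own_orbit(3)[of b] by auto
  have only: "d = along G b \<or> d = across G b"
    if d: "d \<noteq> b" "X \<in> ?R" "{b, d} \<in> disk_boundary G X" for X d
  proof (cases "X \<in> Vertex_Disk ` vertices G")
    case True
    then show ?thesis using disk d(3) by blast
  next
    case False
    then obtain e where e: "X = Edge_Quad e" "e \<in> E" using d(2) by blast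
    then obtain c where c: "c \<in> e" "{b, d} = {c, across G c} \<or> {b, d} = {c, along G c}"
      using d(3) by auto
    then show ?thesis
      using edge_flags[OF e(2) c(1)] v.h_simps(3)[of c] f.h_simps(3)[of c]
      by (auto simp: doubleton_eq_iff)
  qed
  have across_iff: "{b, across G b} \<in> region_boundary G ?R \<longleftrightarrow> edge_of G b \<notin> E"
  proof
    assume "{b, across G b} \<in> region_boundary G ?R"
    then have "\<exists>!X. X \<in> ?R \<and> {b, across G b} \<in> disk_boundary G X"
      by (simp add: region_boundary_def)
    then show "edge_of G b \<notin> E"
      using mem_disk mem_quad(1)
      by (metis UnI2 corner_graph_face.distinct(1) imageI)
  next
    assume "edge_of G b \<notin> E"
    then have "X = Vertex_Disk (vertex_of G b)"
      if "X \<in> ?R" "{b, across G b} \<in> disk_boundary G X" for X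
      using that disk quad by blast
    then show "{b, across G b} \<in> region_boundary G ?R"
      using mem_disk by (auto simp: region_boundary_def intro!: ex1I[of _ "Vertex_Disk (vertex_of G b)"])
  qed
  have along_iff: "{b, along G b} \<in> region_boundary G ?R \<longleftrightarrow> edge_of G b \<in> E"
  proof
    assume "{b, along G b} \<in> region_boundary G ?R"
    then obtain X where "X \<in> ?R" "{b, along G b} \<in> disk_boundary G X"
      by (auto simp: region_boundary_def)
    then show "edge_of G b \<in> E"
      using disk quad along_ne_across[OF b] by blast
  next
    assume "edge_of G b \<in> E"
    moreover have "X = Edge_Quad (edge_of G b)"
      if "X \<in> ?R" "{b, along G b} \<in> disk_boundary G X" for X
      using that disk quad along_ne_across[OF b] by blast
    ultimately have "\<exists>!X. X \<in> ?R \<and> {b, along G b} \<in> disk_boundary G X"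
      using mem_quad(2) by blast
    then show "{b, along G b} \<in> region_boundary G ?R"
      by (simp add: region_boundary_def)
  qed
  have ends: "{b, d} \<in> region_boundary G ?R \<and> d \<noteq> b \<longleftrightarrow>
      d = (if edge_of G b \<in> E then along G b else across G b)" for d
  proof
    assume d: "{b, d} \<in> region_boundary G ?R \<and> d \<noteq> b"
    then have "\<exists>X. X \<in> ?R \<and> {b, d} \<in> disk_boundary G X"
      by (auto simp: region_boundary_def)
    then have "d = along G b \<or> d = across G b" using only d by blast
    then show "d = (if edge_of G b \<in> E then along G b else across G b)"
      using d across_iff along_iff by auto
  next
    assume "d = (if edge_of G b \<in> E then along G b else across G b)"
    then show "{b, d} \<in> region_boundary G ?R \<and> d \<noteq> b"
      using across_iff along_iff b by auto
  qed
  show ?thesis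
    unfolding opposite_end_def
    by (rule the_equality) (use ends in blast)+
qed

lemma H_flags [simp]: "flags H = flags G"
  and H_turn [simp]: "turn H = turn G"
  by (simp_all add: partial_dual_def)

lemma H_across:
  "b \<in> flags G \<Longrightarrow> across H b = (if dual_flag b then along G b else across G b)"
  using opposite_end_region_boundary[OF _ D_edges]
  by (simp add: partial_dual_def region_Delta_def dual_flag_def)

lemma H_along:
  "b \<in> flags G \<Longrightarrow> along H b = (if dual_flag b then across G b else along G b)"
  using opposite_end_region_boundary[of b "edges G - D"]
  by (simp add: partial_dual_def region_Pi_def dual_flag_def)

lemma dual_flag_invariant [simp]:
  assumes "b \<in> flags G"
  shows "dual_flag (along G b) = dual_flag b" "dual_flag (across G b) = dual_flag b"
    "dual_flag (along H b) = dual_flag b" "dual_flag (across H b) = dual_flag b"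
  using assms by (simp_all add: dual_flag_def orbit_invariant H_along H_across)

text \<open>On each edge the same two commuting involutions are kept or exchanged as a whole, and
  neither leaves the edge.\<close>

sublocale H: flag_system H
proof
  show "free_involution_on (flags H) (along H)" "free_involution_on (flags H) (across H)"
    by (auto simp: free_involution_on_def H_along H_across)
  show "free_involution_on (flags H) (turn H)" "finite (flags H)"
    using turn_inv finite_flags by simp_all
  show "along H b \<noteq> across H b" if "b \<in> flags H" for b
    using that along_ne_across[of b] along_ne_across[of b, symmetric]
    by (simp add: H_along H_across)
  show "along H (across H b) = across H (along H b)" if "b \<in> flags H" for b
    using that along_across by (auto simp: H_along H_across)
qed

lemma pure_iff:
  assumes "X \<subseteq> flags G"
  shows "primal_pure G D X \<longleftrightarrow> (\<forall>b\<in>X. \<not> dual_flag b)"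
    and "dual_pure G D X \<longleftrightarrow> (\<forall>b\<in>X. dual_flag b)"
    and "mixed G D X \<longleftrightarrow> bicoloured X"
proof -
  have incident: "incident_edges G X = edge_of G ` X"
  proof
    show "incident_edges G X \<subseteq> edge_of G ` X"
    proof
      fix e assume "e \<in> incident_edges G X"
      then obtain c b where "e = edge_of G c" "b \<in> edge_of G c" "b \<in> X"
        by (auto simp: incident_edges_def edges_def)
      then show "e \<in> edge_of G ` X" using orbit_eq_iff(3)[of b c] by auto
    qed
    show "edge_of G ` X \<subseteq> incident_edges G X"
    proof (rule image_subsetI)
      fix b assume "b \<in> X"
      then show "edge_of G b \<in> incident_edges G X"
        using assms IntI[OF mem_own_orbit(3)[of b]] by (auto simp: incident_edges_def simp del: mem_own_orbit)
    qed
  qed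
  show primal: "primal_pure G D X \<longleftrightarrow> (\<forall>b\<in>X. \<not> dual_flag b)"
    using assms by (auto simp: primal_pure_def incident dual_flag_def)
  show dual: "dual_pure G D X \<longleftrightarrow> (\<forall>b\<in>X. dual_flag b)"
    by (auto simp: dual_pure_def incident dual_flag_def)
  show "mixed G D X \<longleftrightarrow> bicoloured X"
    by (auto simp: mixed_def primal dual bicoloured_def)
qed

section \<open>Orbits of the partial dual compared with orbits of \<open>G\<close>\<close>

lemma mixed_corner_iff:
  "b \<in> flags G \<Longrightarrow> mixed G D {b, turn G b} \<longleftrightarrow> dual_flag (turn G b) \<noteq> dual_flag b"
  by (auto simp: pure_iff bicoloured_def)

text \<open>A one-coloured orbit of \<open>b\<close> consists of flags with the colour of
  \<open>b\<close>, where the two step maps agree, so exchanging the maps does not change it. Used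
  in both directions, this shows that the two orbits are one-coloured together.\<close>

lemma orbit_change_step:
  assumes b: "b \<in> flags G"
    and agree: "\<And>c. c \<in> flags G \<Longrightarrow> dual_flag c = dual_flag b \<Longrightarrow> k c = h c"
  shows "bicoloured (flag_orbit (flags G) {t, h} b) \<longleftrightarrow>
      bicoloured (flag_orbit (flags G) {t, k} b)" (is ?same)
    and "\<not> bicoloured (flag_orbit (flags G) {t, h} b) \<Longrightarrow>
      flag_orbit (flags G) {t, h} b = flag_orbit (flags G) {t, k} b"
proof -
  have *: "flag_orbit (flags G) {t, k'} b = flag_orbit (flags G) {t, h'} b"
    if "\<not> bicoloured (flag_orbit (flags G) {t, h'} b)"
      "\<And>c. c \<in> flags G \<Longrightarrow> dual_flag c = dual_flag b \<Longrightarrow> k' c = h' c" for h' k'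
  proof (rule flag_orbit_cong_on)
    fix c assume "c \<in> flag_orbit (flags G) {t, h'} b" "c \<in> flags G"
    then show "k' c = h' c"
      using that flag_orbit_self[of b "flags G" "{t, h'}"] unfolding bicoloured_def by metis
  qed
  show ?same using *[of h k] *[of k h] agree by metis
  show "flag_orbit (flags G) {t, h} b = flag_orbit (flags G) {t, k} b"
    if "\<not> bicoloured (flag_orbit (flags G) {t, h} b)"
    using *[of h k] agree that by simp
qed

lemma primal_flag_orbits:
  assumes "b \<in> flags G" "\<not> dual_flag b"
  shows "bicoloured (vertex_of H b) \<longleftrightarrow> bicoloured (vertex_of G b)"
    "\<not> bicoloured (vertex_of H b) \<Longrightarrow> vertex_of H b = vertex_of G b"
    "bicoloured (face_of H b) \<longleftrightarrow> bicoloured (face_of G b)"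
    "\<not> bicoloured (face_of H b) \<Longrightarrow> face_of H b = face_of G b"
  unfolding vertex_of_def face_of_turn_along H.face_of_turn_along H_flags H_turn
  by (rule orbit_change_step[OF assms(1)]; use assms(2) in \<open>simp add: H_across H_along\<close>)+

text \<open>Near a dual flag the partial dual looks like the geometric dual of \<open>G\<close>, so
  vertices are compared with faces.\<close>

lemma dual_flag_orbits:
  assumes "b \<in> flags G" "dual_flag b"
  shows "bicoloured (vertex_of H b) \<longleftrightarrow> bicoloured (face_of G b)"
    "\<not> bicoloured (vertex_of H b) \<Longrightarrow> vertex_of H b = face_of G b"
    "bicoloured (face_of H b) \<longleftrightarrow> bicoloured (vertex_of G b)"
    "\<not> bicoloured (face_of H b) \<Longrightarrow> face_of H b = vertex_of G b"
  unfolding vertex_of_def face_of_turn_along H.face_of_turn_along H_flags H_turn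
  by (rule orbit_change_step[OF assms(1)]; use assms(2) in \<open>simp add: H_across H_along\<close>)+

end

section \<open>Petrie walks of the separation graph\<close>

context partial_duality
begin

abbreviation Zx :: "('a \<times> radial_end) embedding" where
  "Zx \<equiv> petrie_dual (separation_graph G D)"

definition at_mixed_corner :: "'a \<Rightarrow> bool" where
  "at_mixed_corner b \<longleftrightarrow> dual_flag (turn G b) \<noteq> dual_flag b"

text \<open>
  Here \<open>h\<close> is \<open>across H\<close> or \<open>along H\<close>.  A walk tracing with \<open>h\<close> changes between \<open>C_v\<close> and \<open>A_f\<close>
  precisely when the colour of its flags changes.
\<close>

definition walk_end :: "('a \<Rightarrow> 'a) \<Rightarrow> 'a \<Rightarrow> radial_end" where
  "walk_end h b = (if h b = across G b then At_Vertex else At_Face)"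

text \<open>Treats vertices (\<open>h = across H\<close>) and faces (\<open>h = along H\<close>) of
  the partial dual in one argument.\<close>

definition trace_orbit :: "('a \<Rightarrow> 'a) \<Rightarrow> 'a \<Rightarrow> 'a set" where
  "trace_orbit h = flag_orbit (flags G) {turn G, h}"

lemma trace_orbit_simps:
  "trace_orbit (across H) b = vertex_of H b" "trace_orbit (along H) b = face_of H b"
  by (simp_all add: trace_orbit_def vertex_of_def H.face_of_turn_along)

lemma Zx_simps:
  "flags Zx = {(b, s). b \<in> flags G \<and> at_mixed_corner b}"
  "along Zx (b, s) = (turn G b, other_end s)"
  "across Zx (b, s) = (turn G b, s)"
  "turn Zx (b, s) =
    (next_mixed G D (case s of At_Vertex \<Rightarrow> across G | At_Face \<Rightarrow> along G) b, s)"
  by (auto simp: petrie_dual_def separation_graph_def at_mixed_corner_def mixed_corner_iff)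

lemma at_mixed_corner_turn [simp]:
  "b \<in> flags G \<Longrightarrow> at_mixed_corner (turn G b) \<longleftrightarrow> at_mixed_corner b"
  by (auto simp: at_mixed_corner_def)

text \<open>For fixed \<open>h\<close> the end depends on the colour only: \<open>across H\<close>
  follows \<open>C_v\<close> at primal and \<open>A_f\<close> at dual flags, and
  \<open>along H\<close> does the reverse.\<close>

lemma walk_end_cong:
  assumes "h \<in> {across H, along H}" "b \<in> flags G" "c \<in> flags G"
  shows "dual_flag c = dual_flag b \<Longrightarrow> walk_end h c = walk_end h b"
    and "dual_flag c \<noteq> dual_flag b \<Longrightarrow> walk_end h c = other_end (walk_end h b)"
  using assms along_ne_across by (auto simp: walk_end_def H_across H_along)

text \<open>This keeps apart the two Petrie walks through an edge of the separation graph: at each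
  flag they use different ends.\<close>

lemma walk_end_along_H:
  "b \<in> flags G \<Longrightarrow> walk_end (along H) b = other_end (walk_end (across H) b)"
  using along_ne_across[of b] by (simp add: walk_end_def H_across H_along)

text \<open>While the colour of \<open>b\<close> persists, rotating in \<open>G\<close> about the
  end chosen at \<open>b\<close> is the same as tracing with \<open>h\<close>.\<close>

lemma walk_end_step:
  assumes "h \<in> {across H, along H}" "b \<in> flags G" "c \<in> flags G" "dual_flag c = dual_flag b"
  shows "(case walk_end h b of At_Vertex \<Rightarrow> across G | At_Face \<Rightarrow> along G) c = h c"
  using assms along_ne_across by (auto simp: walk_end_def H_across H_along)

lemma involution_pair_H:
  "h \<in> {across H, along H} \<Longrightarrow> involution_pair (flags G) (turn G) h"
  using H.f.involution_pair_axioms H.v.involution_pair_axioms by auto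

lemma trace_orbit_closed:
  assumes "h \<in> {across H, along H}" "b \<in> flags G"
  shows "trace_orbit h b \<subseteq> flags G"
    and "c \<in> trace_orbit h b \<Longrightarrow> turn G c \<in> trace_orbit h b"
    and "c \<in> trace_orbit h b \<Longrightarrow> h c \<in> trace_orbit h b"
proof -
  interpret h: involution_pair "flags G" "turn G" h using involution_pair_H assms(1) .
  show sub: "trace_orbit h b \<subseteq> flags G"
    unfolding trace_orbit_def
    by (rule flag_orbit_in_flags) (use assms h.t_inv h.h_inv in auto)
  show "c \<in> trace_orbit h b \<Longrightarrow> turn G c \<in> trace_orbit h b"
    "c \<in> trace_orbit h b \<Longrightarrow> h c \<in> trace_orbit h b"
    using sub flag_orbit_step[of c "flags G" "{turn G, h}" b]
    unfolding trace_orbit_def by auto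
qed

lemma trace_orbit_eq_iff:
  assumes "h \<in> {across H, along H}"
  shows "trace_orbit h c = trace_orbit h b \<longleftrightarrow> c \<in> trace_orbit h b"
proof -
  interpret h: involution_pair "flags G" "turn G" h using involution_pair_H assms(1) .
  show ?thesis
    unfolding trace_orbit_def
    by (rule flag_orbit_eq_iff) (use h.t_inv h.h_inv in auto)
qed

section \<open>Faces of the Petrie dual as traces of the partial dual\<close>

lemma mem_passage_flags_iff:
  assumes "h \<in> {across H, along H}" "W \<subseteq> flags G"
  shows "(c, s) \<in> passage_flags G D h W \<longleftrightarrow> c \<in> W \<and> at_mixed_corner c \<and> s = walk_end h c"
  using assms along_ne_across
  by (auto simp: passage_flags_def mixed_corner_iff at_mixed_corner_def walk_end_def
      H_across H_along subset_iff) metis+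

text \<open>Between consecutive mixed corners the colour is constant, so the trace stays at one
  vertex or in one face of \<open>G\<close> and \<open>next_mixed\<close> follows it step by
  step.\<close>

lemma next_mixed_walk:
  assumes h: "h \<in> {across H, along H}" and b: "b \<in> flags G" "at_mixed_corner b"
  obtains n where "at_mixed_corner (involution_pair.rot (turn G) h (Suc n) b)"
    "\<And>m. m < n \<Longrightarrow> \<not> at_mixed_corner (involution_pair.rot (turn G) h (Suc m) b)"
    "turn Zx (b, walk_end h b) =
      (h (involution_pair.rot (turn G) h n b), walk_end h (h (involution_pair.rot (turn G) h n b)))"
proof -
  interpret h: involution_pair "flags G" "turn G" h using involution_pair_H h .
  define n where "n = (LEAST n. at_mixed_corner (h.rot (Suc n) b))"
  \<comment> \<open>The trace returns to the mixed corner of \<open>b\<close>, so a next mixed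
    corner exists, possibly the same one.\<close>
  obtain N where "0 < N" "h.rot N b = b" using h.period_exists b(1) .
  then have "at_mixed_corner (h.rot (Suc (N - 1)) b)" using b(2) by simp
  then have n: "at_mixed_corner (h.rot (Suc n) b)" unfolding n_def by (rule LeastI)
  have min: "\<not> at_mixed_corner (h.rot (Suc m) b)" if "m < n" for m
    using that unfolding n_def by (rule not_less_Least)
  define step where "step = (case walk_end h b of At_Vertex \<Rightarrow> across G | At_Face \<Rightarrow> along G)"
  have dual_h: "dual_flag (h c) = dual_flag c" if "c \<in> flags G" for c
    using h that by auto
  \<comment> \<open>The sequence in \<open>next_mixed\<close> lists the flags
    \<open>h (h.rot m b)\<close> by which the trace enters its corners;
    \<open>h.rot (Suc m) b\<close> is the other flag of the same corner. Hence the shift by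
    one.\<close>
  have walk: "((step \<circ> turn G) ^^ m) (step b) = h (h.rot m b) \<and>
      dual_flag (h (h.rot m b)) = dual_flag b" if "m \<le> n" for m
    using that
  proof (induction m)
    case 0
    then show ?case
      using walk_end_step[OF h b(1) b(1)] dual_h b by (simp add: step_def)
  next
    case (Suc m)
    have IH: "((step \<circ> turn G) ^^ m) (step b) = h (h.rot m b)"
      "dual_flag (h (h.rot m b)) = dual_flag b"
      using Suc.IH Suc.prems by (blast dest: Suc_leD)+
    have in_flags: "h.rot (Suc m) b \<in> flags G" by (rule h.rot_in[OF b(1)])
    have "dual_flag (h.rot (Suc m) b) = dual_flag b"
      using min[of m] Suc.prems IH(2) h.rot_in[OF b(1), of m]
      by (simp add: at_mixed_corner_def)
    then have dual: "step (h.rot (Suc m) b) = h (h.rot (Suc m) b)"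
      "dual_flag (h (h.rot (Suc m) b)) = dual_flag b"
      unfolding step_def using walk_end_step[OF h b(1) in_flags] dual_h[OF in_flags] by blast+
    have *: "((step \<circ> turn G) ^^ Suc m) (step b) = step (turn G (((step \<circ> turn G) ^^ m) (step b)))"
      by simp
    show ?case
      unfolding * IH(1) h.rot_simps(2)[symmetric] using dual by blast
  qed
  have mixed_iff: "mixed G D {h (h.rot m b), turn G (h (h.rot m b))} \<longleftrightarrow>
      at_mixed_corner (h.rot (Suc m) b)" for m
    using h.rot_in[OF b(1), of m] by (auto simp: mixed_corner_iff at_mixed_corner_def)
  have "(LEAST m. mixed G D {((step \<circ> turn G) ^^ m) (step b),
      turn G (((step \<circ> turn G) ^^ m) (step b))}) = n"
  proof (rule Least_equality)
    show "mixed G D {((step \<circ> turn G) ^^ n) (step b), turn G (((step \<circ> turn G) ^^ n) (step b))}"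
      using walk[of n] mixed_iff[of n] n by simp
    fix m assume "mixed G D {((step \<circ> turn G) ^^ m) (step b), turn G (((step \<circ> turn G) ^^ m) (step b))}"
    then show "n \<le> m"
      using walk[of m] mixed_iff[of m] min[of m] by (metis linorder_not_less nat_less_le)
  qed
  then have "next_mixed G D step b = h (h.rot n b)"
    using walk[of n] by (simp add: next_mixed_def)
  then have turn: "turn Zx (b, walk_end h b) = (h (h.rot n b), walk_end h b)"
    by (simp add: Zx_simps step_def)
  have end_eq: "walk_end h (h (h.rot n b)) = walk_end h b"
    using walk_end_cong(1)[OF h, of b "h (h.rot n b)"] walk[of n] b(1) by simp
  have "turn Zx (b, walk_end h b) = (h (h.rot n b), walk_end h (h (h.rot n b)))"
    unfolding end_eq by (fact turn)
  from that[OF n _ this] min show thesis .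
qed

text \<open>\<open>turn Zx\<close> carries the trace from one mixed corner to the next. Crossing the
  corner changes the colour and hence the end, and this is \<open>along Zx\<close>, which changes
  side and end at once because of the Petrie twist.\<close>

lemma face_of_Zx:
  assumes h: "h \<in> {across H, along H}" and b: "b \<in> flags G" "at_mixed_corner b"
  shows "face_of Zx (b, walk_end h b) = passage_flags G D h (trace_orbit h b)"
    (is "?F = ?P")
proof -
  interpret h: involution_pair "flags G" "turn G" h using involution_pair_H h .
  note O = trace_orbit_closed[OF h]
  have mem: "(c, s) \<in> ?P \<longleftrightarrow> c \<in> trace_orbit h b \<and> at_mixed_corner c \<and> s = walk_end h c" for c s
    by (rule mem_passage_flags_iff[OF h O(1)[OF b(1)]])
  have along: "along Zx (c, walk_end h c) = (turn G c, walk_end h (turn G c))"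
    if "c \<in> flags G" "at_mixed_corner c" for c
    using that walk_end_cong(2)[OF h, of c "turn G c"] by (simp add: Zx_simps at_mixed_corner_def)
  have F_step: "g (c, s) \<in> ?F" if "(c, s) \<in> ?F" "c \<in> flags G" "at_mixed_corner c"
    "g \<in> {along Zx, turn Zx}" for g c s
    using that flag_orbit_step[of "(c, s)" "flags Zx" "{along Zx, turn Zx}"]
    by (simp add: face_of_def Zx_simps)
  show ?thesis
  proof
    show "?F \<subseteq> ?P"
      unfolding face_of_def
    proof (rule flag_orbit_subset)
      show "(b, walk_end h b) \<in> ?P"
        unfolding mem using b by (simp add: trace_orbit_def)
      fix z g assume z: "z \<in> ?P" "z \<in> flags Zx" "g \<in> {along Zx, turn Zx}"
      obtain c where c: "z = (c, walk_end h c)" "c \<in> trace_orbit h b" "at_mixed_corner c"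
        using z(1) mem by (metis surj_pair)
      have cf: "c \<in> flags G" using O(1) b(1) c(2) by blast
      have "along Zx z \<in> ?P"
        using along[OF cf c(3)] O(2)[OF b(1) c(2)] cf c by (simp add: mem)
      moreover have "turn Zx z \<in> ?P"
      proof -
        obtain n where n: "at_mixed_corner (h.rot (Suc n) c)"
          "turn Zx (c, walk_end h c) = (h (h.rot n c), walk_end h (h (h.rot n c)))"
          using next_mixed_walk[OF h cf c(3)] by blast
        have "h.rot k c \<in> trace_orbit h b" for k
          by (induction k) (use c O(2,3) b in auto)
        then have "h (h.rot n c) \<in> trace_orbit h b" using O(3) b by blast
        moreover have "at_mixed_corner (h (h.rot n c))"
          using n(1) h.rot_in[OF cf, of n] by simp
        ultimately show ?thesis using n(2) c(1) by (simp add: mem)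
      qed
      ultimately show "g z \<in> ?P" using z(3) by blast
    qed
    \<comment> \<open>Induction on the length of the trace, removing a whole passage from one mixed
      corner to the next each time.\<close>
    have rot: "(h.rot k c, walk_end h (h.rot k c)) \<in> ?F"
      if "(c, walk_end h c) \<in> ?F" "c \<in> flags G" "at_mixed_corner c"
        "at_mixed_corner (h.rot k c)" for k c
      using that
    proof (induction k arbitrary: c rule: less_induct)
      case (less k)
      show ?case
      proof (cases k)
        case 0
        then show ?thesis using less.prems by simp
      next
        case (Suc l)
        obtain n where n: "at_mixed_corner (h.rot (Suc n) c)"
          "\<And>m. m < n \<Longrightarrow> \<not> at_mixed_corner (h.rot (Suc m) c)"
          "turn Zx (c, walk_end h c) = (h (h.rot n c), walk_end h (h (h.rot n c)))"
          using next_mixed_walk[OF h less.prems(2,3)] by blast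
        have nl: "n \<le> l" using n(2)[of l] less.prems(4) Suc by (metis linorder_not_less)
        let ?d = "h.rot (Suc n) c"
        have hc: "h (h.rot n c) \<in> flags G" "at_mixed_corner (h (h.rot n c))"
          using n(1) h.rot_in[OF less.prems(2), of n] by simp_all
        have "turn Zx (c, walk_end h c) \<in> ?F"
          using F_step[OF less.prems(1-3)] by blast
        then have "(h (h.rot n c), walk_end h (h (h.rot n c))) \<in> ?F"
          unfolding n(3) .
        then have "along Zx (h (h.rot n c), walk_end h (h (h.rot n c))) \<in> ?F"
          using F_step hc by blast
        then have d: "(?d, walk_end h ?d) \<in> ?F"
          unfolding along[OF hc] by simp
        have "h.rot k c = h.rot (k - Suc n) ?d"
          using h.rot_add[of "k - Suc n" "Suc n" c] Suc nl by simp
        then show ?thesis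
          using less.IH[of "k - Suc n" ?d] d n(1) h.rot_in[OF less.prems(2), of "Suc n"]
            less.prems(4) Suc by simp
      qed
    qed
    have b_in: "(b, walk_end h b) \<in> ?F" by (simp add: face_of_def)
    show "?P \<subseteq> ?F"
    proof
      fix z assume "z \<in> ?P"
      then obtain c where c: "z = (c, walk_end h c)" "c \<in> trace_orbit h b" "at_mixed_corner c"
        using mem by (metis surj_pair)
      obtain k where "c = h.rot k b \<or> c = turn G (h.rot k b)"
        using c(2) unfolding trace_orbit_def h.dihedral_orbit[OF b(1)] by blast
      then show "z \<in> ?F"
      proof
        assume "c = h.rot k b"
        then show ?thesis using rot[OF b_in b] c by simp
      next
        assume ck: "c = turn G (h.rot k b)"
        have k: "h.rot k b \<in> flags G" "at_mixed_corner (h.rot k b)"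
          using c(3) h.rot_in[OF b(1), of k] unfolding ck by simp_all
        then have "along Zx (h.rot k b, walk_end h (h.rot k b)) \<in> ?F"
          using F_step rot[OF b_in b] by blast
        then show ?thesis unfolding along[OF k] c(1) ck .
      qed
    qed
  qed
qed

text \<open>At a flag \<open>b\<close> the two ends are those chosen by \<open>across H\<close> and
  by \<open>along H\<close>, so every flag of \<open>Zx\<close> lies on a walk of one of these two
  kinds.\<close>

lemma faces_Zx:
  "faces Zx = {passage_flags G D h (trace_orbit h b) | h b.
    h \<in> {across H, along H} \<and> b \<in> flags G \<and> at_mixed_corner b}" (is "_ = ?R")
proof
  show "faces Zx \<subseteq> ?R"
  proof
    fix F assume "F \<in> faces Zx"
    then obtain b s where b: "F = face_of Zx (b, s)" "b \<in> flags G" "at_mixed_corner b"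
      by (auto simp: faces_def Zx_simps)
    have "s = walk_end (across H) b \<or> s = walk_end (along H) b"
      using walk_end_along_H[OF b(2)] by (cases s; cases "walk_end (across H) b") auto
    then obtain h where "h \<in> {across H, along H}" "s = walk_end h b" by blast
    then show "F \<in> ?R" using face_of_Zx[of h b] b by blast
  qed
  show "?R \<subseteq> faces Zx"
  proof
    fix F assume "F \<in> ?R"
    then obtain h b where "h \<in> {across H, along H}" "b \<in> flags G" "at_mixed_corner b"
      "F = passage_flags G D h (trace_orbit h b)" by blast
    then have "F = face_of Zx (b, walk_end h b)" "(b, walk_end h b) \<in> flags Zx"
      using face_of_Zx[of h b] by (simp_all add: Zx_simps)
    then show "F \<in> faces Zx" by (simp add: faces_def)
  qed
qed

text \<open>The four flags (two sides, two ends) of the edge of the separation graph through a mixed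
  corner; the Petrie twist does not change this set.\<close>

definition radial_edge :: "'a \<Rightarrow> ('a \<times> radial_end) set" where
  "radial_edge b = {b, turn G b} \<times> UNIV"

lemma edge_of_Zx:
  assumes "b \<in> flags G" "at_mixed_corner b"
  shows "edge_of Zx (b, s) = radial_edge b"
proof
  show "edge_of Zx (b, s) \<subseteq> radial_edge b"
    unfolding edge_of_def
    by (rule flag_orbit_subset) (use assms in \<open>auto simp: radial_edge_def Zx_simps\<close>)
  have step: "g z \<in> edge_of Zx (b, s)"
    if "z \<in> edge_of Zx (b, s)" "fst z \<in> flags G" "at_mixed_corner (fst z)"
      "g \<in> {along Zx, across Zx}" for g z
    using that flag_orbit_step[of z "flags Zx" "{along Zx, across Zx}"]
    by (cases z) (simp add: edge_of_def Zx_simps)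
  have 0: "(b, s) \<in> edge_of Zx (b, s)" by (simp add: edge_of_def)
  have 1: "(turn G b, s) \<in> edge_of Zx (b, s)"
    using step[OF 0, of "across Zx"] assms by (simp add: Zx_simps)
  have 2: "(turn G b, other_end s) \<in> edge_of Zx (b, s)"
    using step[OF 0, of "along Zx"] assms by (simp add: Zx_simps)
  have 3: "(b, other_end s) \<in> edge_of Zx (b, s)"
    using step[OF 1, of "along Zx"] assms by (simp add: Zx_simps)
  show "radial_edge b \<subseteq> edge_of Zx (b, s)"
  proof
    fix z assume "z \<in> radial_edge b"
    then obtain c e where z: "z = (c, e)" "c = b \<or> c = turn G b" by (auto simp: radial_edge_def)
    moreover have "e = s \<or> e = other_end s" by (cases e; cases s) auto
    ultimately show "z \<in> edge_of Zx (b, s)" using 0 1 2 3 by blast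
  qed
qed

lemma incident_edges_Zx:
  assumes h: "h \<in> {across H, along H}" and b: "b \<in> flags G"
  shows "incident_edges Zx (passage_flags G D h (trace_orbit h b)) =
    radial_edge ` {c \<in> trace_orbit h b. at_mixed_corner c}"
proof -
  note O = trace_orbit_closed[OF h b]
  have edges: "edges Zx = radial_edge ` {c \<in> flags G. at_mixed_corner c}"
    unfolding edges_def using edge_of_Zx by (force simp: Zx_simps)
  have "radial_edge c \<inter> passage_flags G D h (trace_orbit h b) \<noteq> {} \<longleftrightarrow> c \<in> trace_orbit h b"
    if c: "c \<in> flags G" "at_mixed_corner c" for c
  proof
    assume "radial_edge c \<inter> passage_flags G D h (trace_orbit h b) \<noteq> {}"
    then obtain d s where d: "(d, s) \<in> radial_edge c"
      "(d, s) \<in> passage_flags G D h (trace_orbit h b)" by fast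
    then have "d = c \<or> d = turn G c" "d \<in> trace_orbit h b"
      using mem_passage_flags_iff[OF h O(1)] by (auto simp: radial_edge_def)
    then show "c \<in> trace_orbit h b" using O(2)[of "turn G c"] c(1) by auto
  next
    assume "c \<in> trace_orbit h b"
    then have "(c, walk_end h c) \<in> radial_edge c \<inter> passage_flags G D h (trace_orbit h b)"
      using mem_passage_flags_iff[OF h O(1)] c by (simp add: radial_edge_def)
    then show "radial_edge c \<inter> passage_flags G D h (trace_orbit h b) \<noteq> {}" by blast
  qed
  then show ?thesis
    unfolding incident_edges_def edges using O(1) by blast
qed

lemma radial_edge_eq_iff:
  "\<lbrakk>b \<in> flags G; c \<in> flags G\<rbrakk> \<Longrightarrow> radial_edge b = radial_edge c \<longleftrightarrow> \<not> distinct_corners b c"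
  using corner_eq_iff[of b c] by (auto simp: radial_edge_def times_eq_iff)

text \<open>\<open>h\<close> preserves colour, so a trace that meets both colours must change colour
  by \<open>turn\<close>, that is, at a mixed corner.\<close>

lemma bicoloured_trace_orbit:
  assumes h: "h \<in> {across H, along H}" and b: "b \<in> flags G"
  shows "bicoloured (trace_orbit h b) \<longleftrightarrow> (\<exists>c\<in>trace_orbit h b. at_mixed_corner c)"
proof
  note O = trace_orbit_closed[OF h b]
  show "\<exists>c\<in>trace_orbit h b. at_mixed_corner c" if "bicoloured (trace_orbit h b)"
  proof (rule ccontr)
    assume pure: "\<not> (\<exists>c\<in>trace_orbit h b. at_mixed_corner c)"
    have "trace_orbit h b \<subseteq> {c \<in> trace_orbit h b. dual_flag c = dual_flag b}"
      (is "_ \<subseteq> ?S")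
      unfolding trace_orbit_def
    proof (rule flag_orbit_subset, fold trace_orbit_def)
      show "b \<in> ?S" by (simp add: trace_orbit_def)
      fix c g assume c: "c \<in> ?S" "c \<in> flags G" "g \<in> {turn G, h}"
      then have "turn G c \<in> ?S" using O(2) pure by (auto simp: at_mixed_corner_def)
      moreover have "h c \<in> ?S" using c O(3) h by auto
      ultimately show "g c \<in> ?S" using c(3) by blast
    qed
    then show False using that by (auto simp: bicoloured_def)
  qed
  show "bicoloured (trace_orbit h b)" if "\<exists>c\<in>trace_orbit h b. at_mixed_corner c"
    using that O(2) unfolding bicoloured_def at_mixed_corner_def by metis
qed

text \<open>Being bicoloured provides a mixed corner and so a passage flag. That single flag
  determines the face: its end tells \<open>across H\<close> from \<open>along H\<close>, and its
  first component fixes the orbit.\<close>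

lemma passage_flags_unique:
  assumes h: "h \<in> {across H, along H}" and b: "b \<in> flags G" and bi: "bicoloured (trace_orbit h b)"
  shows "(THE F. F \<in> faces Zx \<and> passage_flags G D h (trace_orbit h b) \<subseteq> F) =
    passage_flags G D h (trace_orbit h b)"
proof (rule the_equality)
  note O = trace_orbit_closed[OF h b]
  obtain c where c: "c \<in> trace_orbit h b" "at_mixed_corner c"
    using bi bicoloured_trace_orbit[OF h b] by blast
  then have cf: "c \<in> flags G" using O(1) by blast
  have same: "trace_orbit h c = trace_orbit h b" using trace_orbit_eq_iff[OF h] c(1) by blast
  then have "\<exists>k d. passage_flags G D h (trace_orbit h b) = passage_flags G D k (trace_orbit k d) \<and>
      k \<in> {across H, along H} \<and> d \<in> flags G \<and> at_mixed_corner d"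
    using h cf c(2) by metis
  then show "passage_flags G D h (trace_orbit h b) \<in> faces Zx \<and>
    passage_flags G D h (trace_orbit h b) \<subseteq> passage_flags G D h (trace_orbit h b)"
    unfolding faces_Zx by blast
  fix F assume F: "F \<in> faces Zx \<and> passage_flags G D h (trace_orbit h b) \<subseteq> F"
  then obtain k d where d: "F = passage_flags G D k (trace_orbit k d)" "k \<in> {across H, along H}"
    "d \<in> flags G" unfolding faces_Zx by blast
  have "(c, walk_end h c) \<in> F"
    using F c mem_passage_flags_iff[OF h O(1)] by blast
  then have k: "c \<in> trace_orbit k d" "walk_end h c = walk_end k c"
    using mem_passage_flags_iff[OF d(2) trace_orbit_closed(1)[OF d(2,3)]] d(1) by blast+
  have "other_end s \<noteq> s" for s by (cases s) auto
  then have "k = h" using k(2) h d(2) walk_end_along_H[OF cf] by auto metis+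
  then show "F = passage_flags G D h (trace_orbit h b)"
    using k(1) d(1) same trace_orbit_eq_iff[OF h] by metis
qed

lemma petrie_face_eq:
  assumes "b \<in> flags G"
  shows "bicoloured (vertex_of H b) \<Longrightarrow> petrie_face_of_vertex G D (vertex_of H b) =
      passage_flags G D (across H) (vertex_of H b)"
    and "bicoloured (face_of H b) \<Longrightarrow> petrie_face_of_face G D (face_of H b) =
      passage_flags G D (along H) (face_of H b)"
  unfolding petrie_face_of_vertex_def petrie_face_of_face_def trace_orbit_simps[symmetric]
  using passage_flags_unique assms by blast+

end

section \<open>The three conditions\<close>

context partial_duality
begin

lemma H_distinct_corners [simp]: "H.distinct_corners = distinct_corners"
  by (intro ext) (simp add: H.distinct_corners_def distinct_corners_def)

lemma distinct_corners_sym: "distinct_corners b c \<Longrightarrow> distinct_corners c b"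
  by (auto simp: distinct_corners_def)

lemma H_corner_eq:
  "b \<in> flags G \<Longrightarrow> corner_vertex H {b, turn G b} = vertex_of H b"
  "b \<in> flags G \<Longrightarrow> corner_face H {b, turn G b} = face_of H b"
  using H.corner_vertex_eq[of b] H.corner_face_eq[of b] by simp_all

lemma H_orbit_subset_flags:
  "b \<in> flags G \<Longrightarrow> vertex_of H b \<subseteq> flags G" "b \<in> flags G \<Longrightarrow> face_of H b \<subseteq> flags G"
  using H.orbit_subset_flags[of b] by simp_all

section \<open>Condition (LC)\<close>

lemma mixed_orbit_iff:
  assumes "b \<in> flags G"
  shows "mixed G D (vertex_of G b) \<longleftrightarrow> bicoloured (vertex_of G b)"
    "mixed G D (face_of G b) \<longleftrightarrow> bicoloured (face_of G b)"
  using assms orbit_subset_flags by (simp_all add: pure_iff)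

text \<open>The colour of \<open>b\<close> decides which orbit of \<open>G\<close> matches which
  orbit of \<open>H\<close>; statements symmetric in vertex and face transfer for both
  colours.\<close>

lemma bicoloured_H_orbits_iff:
  assumes "b \<in> flags G"
  shows "bicoloured (vertex_of H b) \<and> bicoloured (face_of H b) \<longleftrightarrow>
      bicoloured (vertex_of G b) \<and> bicoloured (face_of G b)"
    and "bicoloured (vertex_of H b) \<or> bicoloured (face_of H b) \<longleftrightarrow>
      bicoloured (vertex_of G b) \<or> bicoloured (face_of G b)"
  using primal_flag_orbits(1,3)[OF assms] dual_flag_orbits(1,3)[OF assms] by blast+

text \<open>If neither orbit at \<open>b\<close> is bicoloured, the vertex and face of the partial
  dual are the vertex and face of \<open>G\<close>, possibly exchanged, so common corners are the
  same in both.\<close>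

lemma LC_iff:
  "LC G D \<longleftrightarrow> (\<forall>b c. distinct_corners b c \<longrightarrow> c \<in> vertex_of H b \<longrightarrow> c \<in> face_of H b \<longrightarrow>
     bicoloured (vertex_of H b) \<or> bicoloured (face_of H b))"
proof -
  have bad: "bad_pair G v f \<longleftrightarrow> (\<exists>b c. distinct_corners b c \<and>
      (vertex_of G b = v \<and> face_of G b = f) \<and> (vertex_of G c = v \<and> face_of G c = f))" for v f
    unfolding bad_pair_def
    by (rule card_corners_gt_1) (simp add: corner_vertex_eq corner_face_eq)
  have "LC G D \<longleftrightarrow> (\<forall>b c. distinct_corners b c \<longrightarrow>
      vertex_of G c = vertex_of G b \<longrightarrow> face_of G c = face_of G b \<longrightarrow>
      bicoloured (vertex_of G b) \<or> bicoloured (face_of G b))"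
  proof
    assume L: "LC G D"
    show "\<forall>b c. distinct_corners b c \<longrightarrow>
      vertex_of G c = vertex_of G b \<longrightarrow> face_of G c = face_of G b \<longrightarrow>
      bicoloured (vertex_of G b) \<or> bicoloured (face_of G b)"
    proof (intro allI impI)
      fix b c assume bc: "distinct_corners b c" "vertex_of G c = vertex_of G b"
        "face_of G c = face_of G b"
      then have b: "b \<in> flags G" by (simp add: distinct_corners_def)
      have "bad_pair G (vertex_of G b) (face_of G b)" unfolding bad using bc by blast
      then show "bicoloured (vertex_of G b) \<or> bicoloured (face_of G b)"
        using L b mixed_orbit_iff[OF b] by (auto simp: LC_def vertices_def faces_def)
    qed
  next
    assume R: "\<forall>b c. distinct_corners b c \<longrightarrow>
      vertex_of G c = vertex_of G b \<longrightarrow> face_of G c = face_of G b \<longrightarrow>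
      bicoloured (vertex_of G b) \<or> bicoloured (face_of G b)"
    show "LC G D"
      unfolding LC_def
    proof (intro ballI impI)
      fix v f assume "bad_pair G v f"
      then obtain b c where bc: "distinct_corners b c" "vertex_of G b = v" "face_of G b = f"
        "vertex_of G c = v" "face_of G c = f" unfolding bad by blast
      then have b: "b \<in> flags G" by (simp add: distinct_corners_def)
      have "bicoloured v \<or> bicoloured f" using R bc by metis
      then show "mixed G D v \<or> mixed G D f" using mixed_orbit_iff[OF b] bc by simp
    qed
  qed
  also have "\<dots> \<longleftrightarrow> (\<forall>b c. distinct_corners b c \<longrightarrow>
      c \<in> vertex_of H b \<longrightarrow> c \<in> face_of H b \<longrightarrow>
      bicoloured (vertex_of H b) \<or> bicoloured (face_of H b))"
  proof -
    have "vertex_of G c = vertex_of G b \<and> face_of G c = face_of G b \<longleftrightarrow>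
        c \<in> vertex_of H b \<and> c \<in> face_of H b"
      if "b \<in> flags G" "\<not> (bicoloured (vertex_of H b) \<or> bicoloured (face_of H b))" for b c
      using primal_flag_orbits(2,4)[OF that(1)] dual_flag_orbits(2,4)[OF that(1)] that(2)
      unfolding orbit_eq_iff by (cases "dual_flag b") auto
    then show ?thesis
      using bicoloured_H_orbits_iff(2) unfolding distinct_corners_def by blast
  qed
  finally show ?thesis .
qed

section \<open>Condition (MC)\<close>

lemma dual_region_walks_eq:
  "dual_region_walks G D = vertex_of H ` {b \<in> flags G. bicoloured (vertex_of H b)}"
proof -
  \<comment> \<open>The orbits taken out are the one-coloured ones: a vertex of the partial dual
    with only primal flags is a vertex of \<open>G\<close>, one with only dual flags is a face of
    \<open>G\<close>.\<close>
  have removed: "vertex_of H b \<in> {v \<in> vertices G. primal_pure G D v} \<union> {f \<in> faces G. dual_pure G D f}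
      \<longleftrightarrow> \<not> bicoloured (vertex_of H b)" if b: "b \<in> flags G" for b
  proof
    note pure = pure_iff(1,2)[OF H_orbit_subset_flags(1)[OF b]]
    show "vertex_of H b \<in> {v \<in> vertices G. primal_pure G D v} \<union> {f \<in> faces G. dual_pure G D f}
      \<Longrightarrow> \<not> bicoloured (vertex_of H b)"
      using pure by (auto simp: bicoloured_def)
    assume nb: "\<not> bicoloured (vertex_of H b)"
    show "vertex_of H b \<in> {v \<in> vertices G. primal_pure G D v} \<union> {f \<in> faces G. dual_pure G D f}"
    proof (cases "dual_flag b")
      case True
      then have "dual_pure G D (vertex_of H b)"
        using nb H.mem_own_orbit(1)[of b] unfolding pure bicoloured_def by blast
      moreover have "vertex_of H b \<in> faces G"
        using dual_flag_orbits(2)[OF b True nb] b by (simp add: faces_def)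
      ultimately show ?thesis by blast
    next
      case False
      then have "primal_pure G D (vertex_of H b)"
        using nb H.mem_own_orbit(1)[of b] unfolding pure bicoloured_def by blast
      moreover have "vertex_of H b \<in> vertices G"
        using primal_flag_orbits(2)[OF b False nb] b by (simp add: vertices_def)
      ultimately show ?thesis by blast
    qed
  qed
  show ?thesis
    unfolding dual_region_walks_def vertices_def[of H] H_flags using removed by blast
qed

lemma primal_region_walks_eq:
  "primal_region_walks G D = face_of H ` {b \<in> flags G. bicoloured (face_of H b)}"
proof -
  have removed: "face_of H b \<in> {f \<in> faces G. primal_pure G D f} \<union> {v \<in> vertices G. dual_pure G D v}
      \<longleftrightarrow> \<not> bicoloured (face_of H b)" if b: "b \<in> flags G" for b
  proof
    note pure = pure_iff(1,2)[OF H_orbit_subset_flags(2)[OF b]]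
    show "face_of H b \<in> {f \<in> faces G. primal_pure G D f} \<union> {v \<in> vertices G. dual_pure G D v}
      \<Longrightarrow> \<not> bicoloured (face_of H b)"
      using pure by (auto simp: bicoloured_def)
    assume nb: "\<not> bicoloured (face_of H b)"
    show "face_of H b \<in> {f \<in> faces G. primal_pure G D f} \<union> {v \<in> vertices G. dual_pure G D v}"
    proof (cases "dual_flag b")
      case True
      then have "dual_pure G D (face_of H b)"
        using nb H.mem_own_orbit(2)[of b] unfolding pure bicoloured_def by blast
      moreover have "face_of H b \<in> vertices G"
        using dual_flag_orbits(4)[OF b True nb] b by (simp add: vertices_def)
      ultimately show ?thesis by blast
    next
      case False
      then have "primal_pure G D (face_of H b)"
        using nb H.mem_own_orbit(2)[of b] unfolding pure bicoloured_def by blast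
      moreover have "face_of H b \<in> faces G"
        using primal_flag_orbits(4)[OF b False nb] b by (simp add: faces_def)
      ultimately show ?thesis by blast
    qed
  qed
  show ?thesis
    unfolding primal_region_walks_def faces_def[of H] H_flags using removed by blast
qed

text \<open>
  One clause of (MC) for pure vertices or faces of colour \<open>p\<close>: \<open>X\<close>, \<open>Y\<close> are the orbits in \<open>G\<close> and
  \<open>X'\<close>, \<open>Y'\<close> those orbits of the partial dual that agree with them locally at flags of colour \<open>p\<close>.
\<close>

lemma region_walks_once_iff:
  fixes X Y X' Y' :: "'a \<Rightarrow> 'a set" and p :: bool
  assumes mem: "\<And>b c. X c = X b \<longleftrightarrow> c \<in> X b" "\<And>b c. X' c = X' b \<longleftrightarrow> c \<in> X' b"
      "\<And>b c. Y' c = Y' b \<longleftrightarrow> c \<in> Y' b"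
    and colour: "\<And>b. b \<in> flags G \<Longrightarrow> dual_flag b = p \<Longrightarrow> bicoloured (X' b) \<longleftrightarrow> bicoloured (X b)"
      "\<And>b. b \<in> flags G \<Longrightarrow> dual_flag b = p \<Longrightarrow> \<not> bicoloured (X' b) \<Longrightarrow> X' b = X b"
      "\<And>b. b \<in> flags G \<Longrightarrow> dual_flag b = p \<Longrightarrow> bicoloured (Y' b) \<longleftrightarrow> bicoloured (Y b)"
    and exposed: "\<And>x. exposed x \<longleftrightarrow> x \<in> X ` flags G \<and> \<not> bicoloured x \<and>
      (\<exists>b c. distinct_corners b c \<and> (X b = x \<and> bicoloured (Y b)) \<and> (X c = x \<and> bicoloured (Y c)))"
    and pure: "\<And>x. x \<in> X ` flags G \<Longrightarrow> pure x \<longleftrightarrow> (\<forall>b\<in>x. dual_flag b = p)"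
    and walks: "walks = Y' ` {b \<in> flags G. bicoloured (Y' b)}"
    and once: "\<And>W x. W \<in> walks \<Longrightarrow> once W x \<longleftrightarrow>
      \<not> (\<exists>b c. distinct_corners b c \<and> (b \<in> W \<and> X b = x) \<and> (c \<in> W \<and> X c = x))"
  shows "(\<forall>x. exposed x \<longrightarrow> pure x \<longrightarrow> (\<forall>W\<in>walks. once W x)) \<longleftrightarrow>
    (\<forall>b c. distinct_corners b c \<longrightarrow> c \<in> X' b \<longrightarrow> c \<in> Y' b \<longrightarrow> dual_flag b = p \<longrightarrow>
        bicoloured (Y' b) \<longrightarrow> bicoloured (X' b))" (is "?L \<longleftrightarrow> ?R")
proof
  assume L: ?L
  show ?R
  proof (intro allI impI, rule ccontr)
    fix b c assume bc: "distinct_corners b c" "c \<in> X' b" "c \<in> Y' b" "dual_flag b = p"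
      "bicoloured (Y' b)" "\<not> bicoloured (X' b)"
    have flags: "b \<in> flags G" "c \<in> flags G" using bc(1) by (auto simp: distinct_corners_def)
    have self: "b \<in> X b" "b \<in> Y' b" using mem by blast+
    have X: "X' b = X b" using colour(2) flags bc by blast
    then have one_colour: "\<forall>d\<in>X b. dual_flag d = p"
      using bc(4,6) self(1) unfolding bicoloured_def by metis
    have c: "X c = X b" "dual_flag c = p" using bc(2) X mem(1) one_colour by auto
    \<comment> \<open>The second corner lies on the same one-coloured orbit, so its flag has colour
      \<open>p\<close> as well and bicolouredness passes from \<open>Y'\<close> to \<open>Y\<close>
      at both corners. They witness that \<open>X b\<close> is exposed.\<close>
    have "Y' c = Y' b" using mem(3) bc(3) by blast
    then have "bicoloured (Y b)" "bicoloured (Y c)"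
      using colour(3)[OF flags(1) bc(4)] colour(3)[OF flags(2) c(2)] bc(5) by simp_all
    then have "exposed (X b)" unfolding exposed using flags(1) bc(1,6) c(1) X by auto
    moreover have "pure (X b)" using pure[of "X b"] flags(1) one_colour by blast
    moreover have W: "Y' b \<in> walks" unfolding walks using flags(1) bc(5) by blast
    ultimately have "once (Y' b) (X b)" using L by blast
    then show False unfolding once[OF W] using bc(1,3) c(1) self(2) by blast
  qed
next
  assume R: ?R
  show ?L
  proof (intro allI impI ballI)
    fix x W assume x': "exposed x" "pure x" and W: "W \<in> walks"
    have x: "\<forall>b\<in>x. dual_flag b = p" using x'(2) pure[of x] x'(1)[unfolded exposed] by simp
    show "once W x"
      unfolding once[OF W]
    proof
      assume "\<exists>b c. distinct_corners b c \<and> (b \<in> W \<and> X b = x) \<and> c \<in> W \<and> X c = x"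
      then obtain b c where bc: "distinct_corners b c" "b \<in> W" "X b = x" "c \<in> W" "X c = x" by blast
      have b: "b \<in> flags G" using bc(1) by (auto simp: distinct_corners_def)
      have in_x: "b \<in> x" "c \<in> x" using mem(1) bc by blast+
      then have "\<not> bicoloured (X b)" "dual_flag b = p" using x bc(3) by (auto simp: bicoloured_def)
      then have X: "\<not> bicoloured (X' b)" "X' b = x" using colour b bc(3) by blast+
      have Y: "Y' b = W" "bicoloured W" using W bc(2) mem(3) unfolding walks by blast+
      show False using R bc(1,4) X Y in_x x by metis
    qed
  qed
qed

text \<open>If only one of the two orbits is bicoloured, the other is a pure orbit of
  \<open>G\<close> whose kind is fixed by the colour of \<open>b\<close>: as a vertex of the partial
  dual it is a primal-pure vertex or a dual-pure face, as a face a primal-pure face or a dual-pure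
  vertex. These are the four clauses.\<close>

lemma MC_iff:
  "MC G D \<longleftrightarrow> (\<forall>b c. distinct_corners b c \<longrightarrow> c \<in> vertex_of H b \<longrightarrow> c \<in> face_of H b \<longrightarrow>
     (bicoloured (vertex_of H b) \<longleftrightarrow> bicoloured (face_of H b)))"
proof -
  have vertex_sub: "v \<subseteq> flags G" if "v \<in> vertices G" for v
    using that orbit_subset_flags(1) unfolding vertices_def by blast
  have face_sub: "f \<subseteq> flags G" if "f \<in> faces G" for f
    using that orbit_subset_flags(2) unfolding faces_def by blast
  have exposed_vertex: "exposed_vertex G D v \<longleftrightarrow> v \<in> vertices G \<and> \<not> bicoloured v \<and>
      (\<exists>b c. distinct_corners b c \<and> (vertex_of G b = v \<and> bicoloured (face_of G b)) \<and>
        (vertex_of G c = v \<and> bicoloured (face_of G c)))" for v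
  proof -
    have "card {y \<in> corners G. corner_vertex G y = v \<and> mixed G D (corner_face G y)} > 1 \<longleftrightarrow>
      (\<exists>b c. distinct_corners b c \<and> (vertex_of G b = v \<and> bicoloured (face_of G b)) \<and>
        (vertex_of G c = v \<and> bicoloured (face_of G c)))"
      by (rule card_corners_gt_1) (simp add: corner_vertex_eq corner_face_eq mixed_orbit_iff)
    then show ?thesis
      unfolding exposed_vertex_def using pure_iff(3)[OF vertex_sub] by blast
  qed
  have exposed_face: "exposed_face G D v \<longleftrightarrow> v \<in> faces G \<and> \<not> bicoloured v \<and>
      (\<exists>b c. distinct_corners b c \<and> (face_of G b = v \<and> bicoloured (vertex_of G b)) \<and>
        (face_of G c = v \<and> bicoloured (vertex_of G c)))" for v
  proof -
    have "card {y \<in> corners G. corner_face G y = v \<and> mixed G D (corner_vertex G y)} > 1 \<longleftrightarrow>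
      (\<exists>b c. distinct_corners b c \<and> (face_of G b = v \<and> bicoloured (vertex_of G b)) \<and>
        (face_of G c = v \<and> bicoloured (vertex_of G c)))"
      by (rule card_corners_gt_1) (simp add: corner_vertex_eq corner_face_eq mixed_orbit_iff)
    then show ?thesis
      unfolding exposed_face_def using pure_iff(3)[OF face_sub] by blast
  qed
  \<comment> \<open>Containing a whole corner can then be tested on one of its flags, as the
    counting lemma requires.\<close>
  have turn_mem: "turn G b \<in> W"
    if W: "b \<in> W" "W \<in> dual_region_walks G D \<union> primal_region_walks G D" for b W
  proof -
    obtain h d where "W = trace_orbit h d" "d \<in> flags G" "h \<in> {across H, along H}"
      using W(2) unfolding dual_region_walks_eq primal_region_walks_eq
      by (auto simp flip: trace_orbit_simps)
    then show ?thesis using trace_orbit_closed(2) W(1) by blast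
  qed
  have once: "passes_at_vertex_once G W v \<longleftrightarrow> \<not> (\<exists>b c. distinct_corners b c \<and>
        (b \<in> W \<and> vertex_of G b = v) \<and> (c \<in> W \<and> vertex_of G c = v))"
    "passes_at_face_once G W v \<longleftrightarrow> \<not> (\<exists>b c. distinct_corners b c \<and>
        (b \<in> W \<and> face_of G b = v) \<and> (c \<in> W \<and> face_of G c = v))"
    if "W \<in> dual_region_walks G D \<union> primal_region_walks G D" for W v
  proof -
    have "card {y \<in> corners G. y \<subseteq> W \<and> corner_vertex G y = v} > 1 \<longleftrightarrow> (\<exists>b c.
        distinct_corners b c \<and> (b \<in> W \<and> vertex_of G b = v) \<and> (c \<in> W \<and> vertex_of G c = v))"
      by (rule card_corners_gt_1) (use turn_mem[OF _ that] in \<open>auto simp: corner_vertex_eq\<close>)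
    then show "passes_at_vertex_once G W v \<longleftrightarrow> \<not> (\<exists>b c. distinct_corners b c \<and>
        (b \<in> W \<and> vertex_of G b = v) \<and> (c \<in> W \<and> vertex_of G c = v))"
      by (simp add: passes_at_vertex_once_def flip: not_less)
    have "card {y \<in> corners G. y \<subseteq> W \<and> corner_face G y = v} > 1 \<longleftrightarrow> (\<exists>b c.
        distinct_corners b c \<and> (b \<in> W \<and> face_of G b = v) \<and> (c \<in> W \<and> face_of G c = v))"
      by (rule card_corners_gt_1) (use turn_mem[OF _ that] in \<open>auto simp: corner_face_eq\<close>)
    then show "passes_at_face_once G W v \<longleftrightarrow> \<not> (\<exists>b c. distinct_corners b c \<and>
        (b \<in> W \<and> face_of G b = v) \<and> (c \<in> W \<and> face_of G c = v))"
      by (simp add: passes_at_face_once_def flip: not_less)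
  qed
  have pure_colour: "primal_pure G D v \<longleftrightarrow> (\<forall>b\<in>v. dual_flag b = False)"
    "dual_pure G D v \<longleftrightarrow> (\<forall>b\<in>v. dual_flag b = True)" if "v \<in> vertices G \<union> faces G" for v
    using that vertex_sub face_sub pure_iff[of v] by auto
  have part1: "(\<forall>x. exposed_vertex G D x \<longrightarrow> primal_pure G D x \<longrightarrow>
        (\<forall>W\<in>primal_region_walks G D. passes_at_vertex_once G W x)) \<longleftrightarrow>
      (\<forall>b c. distinct_corners b c \<longrightarrow> c \<in> vertex_of H b \<longrightarrow> c \<in> face_of H b \<longrightarrow>
        dual_flag b = False \<longrightarrow> bicoloured (face_of H b) \<longrightarrow> bicoloured (vertex_of H b))"
  proof (rule region_walks_once_iff[where X = "vertex_of G" and Y = "face_of G"])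
    fix b c
    show "vertex_of G c = vertex_of G b \<longleftrightarrow> c \<in> vertex_of G b" by (rule orbit_eq_iff)
    show "vertex_of H c = vertex_of H b \<longleftrightarrow> c \<in> vertex_of H b" "face_of H c = face_of H b \<longleftrightarrow> c \<in> face_of H b"
      by (rule H.orbit_eq_iff)+
    assume b: "b \<in> flags G" "dual_flag b = False"
    show "bicoloured (vertex_of H b) \<longleftrightarrow> bicoloured (vertex_of G b)"
      "\<not> bicoloured (vertex_of H b) \<Longrightarrow> vertex_of H b = vertex_of G b"
      "bicoloured (face_of H b) \<longleftrightarrow> bicoloured (face_of G b)"
      using primal_flag_orbits[OF b(1)] b(2) by blast+
  next
    fix x assume "x \<in> vertex_of G ` flags G"
    then show "primal_pure G D x \<longleftrightarrow> (\<forall>b\<in>x. dual_flag b = False)"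
      by (intro pure_colour) (simp add: vertices_def)
  next
    fix W x assume "W \<in> primal_region_walks G D"
    then show "passes_at_vertex_once G W x \<longleftrightarrow> \<not> (\<exists>b c. distinct_corners b c \<and>
        (b \<in> W \<and> vertex_of G b = x) \<and> (c \<in> W \<and> vertex_of G c = x))"
      by (intro once) blast
  qed (rule exposed_vertex[unfolded vertices_def] primal_region_walks_eq)+
  \<comment> \<open>A dual-pure vertex of \<open>G\<close> is a face of the partial dual, so the
    pure orbit is now \<open>face_of H b\<close>.\<close>
  have part2: "(\<forall>x. exposed_vertex G D x \<longrightarrow> dual_pure G D x \<longrightarrow>
        (\<forall>W\<in>dual_region_walks G D. passes_at_vertex_once G W x)) \<longleftrightarrow>
      (\<forall>b c. distinct_corners b c \<longrightarrow> c \<in> face_of H b \<longrightarrow> c \<in> vertex_of H b \<longrightarrow>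
        dual_flag b = True \<longrightarrow> bicoloured (vertex_of H b) \<longrightarrow> bicoloured (face_of H b))"
  proof (rule region_walks_once_iff[where X = "vertex_of G" and Y = "face_of G"])
    fix b c
    show "vertex_of G c = vertex_of G b \<longleftrightarrow> c \<in> vertex_of G b" by (rule orbit_eq_iff)
    show "face_of H c = face_of H b \<longleftrightarrow> c \<in> face_of H b" "vertex_of H c = vertex_of H b \<longleftrightarrow> c \<in> vertex_of H b"
      by (rule H.orbit_eq_iff)+
    assume b: "b \<in> flags G" "dual_flag b = True"
    show "bicoloured (face_of H b) \<longleftrightarrow> bicoloured (vertex_of G b)"
      "\<not> bicoloured (face_of H b) \<Longrightarrow> face_of H b = vertex_of G b"
      "bicoloured (vertex_of H b) \<longleftrightarrow> bicoloured (face_of G b)"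
      using dual_flag_orbits[OF b(1)] b(2) by blast+
  next
    fix x assume "x \<in> vertex_of G ` flags G"
    then show "dual_pure G D x \<longleftrightarrow> (\<forall>b\<in>x. dual_flag b = True)"
      by (intro pure_colour) (simp add: vertices_def)
  next
    fix W x assume "W \<in> dual_region_walks G D"
    then show "passes_at_vertex_once G W x \<longleftrightarrow> \<not> (\<exists>b c. distinct_corners b c \<and>
        (b \<in> W \<and> vertex_of G b = x) \<and> (c \<in> W \<and> vertex_of G c = x))"
      by (intro once) blast
  qed (rule exposed_vertex[unfolded vertices_def] dual_region_walks_eq)+
  have part3: "(\<forall>x. exposed_face G D x \<longrightarrow> dual_pure G D x \<longrightarrow>
        (\<forall>W\<in>primal_region_walks G D. passes_at_face_once G W x)) \<longleftrightarrow>
      (\<forall>b c. distinct_corners b c \<longrightarrow> c \<in> vertex_of H b \<longrightarrow> c \<in> face_of H b \<longrightarrow>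
        dual_flag b = True \<longrightarrow> bicoloured (face_of H b) \<longrightarrow> bicoloured (vertex_of H b))"
  proof (rule region_walks_once_iff[where X = "face_of G" and Y = "vertex_of G"])
    fix b c
    show "face_of G c = face_of G b \<longleftrightarrow> c \<in> face_of G b" by (rule orbit_eq_iff)
    show "vertex_of H c = vertex_of H b \<longleftrightarrow> c \<in> vertex_of H b" "face_of H c = face_of H b \<longleftrightarrow> c \<in> face_of H b"
      by (rule H.orbit_eq_iff)+
    assume b: "b \<in> flags G" "dual_flag b = True"
    show "bicoloured (vertex_of H b) \<longleftrightarrow> bicoloured (face_of G b)"
      "\<not> bicoloured (vertex_of H b) \<Longrightarrow> vertex_of H b = face_of G b"
      "bicoloured (face_of H b) \<longleftrightarrow> bicoloured (vertex_of G b)"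
      using dual_flag_orbits[OF b(1)] b(2) by blast+
  next
    fix x assume "x \<in> face_of G ` flags G"
    then show "dual_pure G D x \<longleftrightarrow> (\<forall>b\<in>x. dual_flag b = True)"
      by (intro pure_colour) (simp add: faces_def)
  next
    fix W x assume "W \<in> primal_region_walks G D"
    then show "passes_at_face_once G W x \<longleftrightarrow> \<not> (\<exists>b c. distinct_corners b c \<and>
        (b \<in> W \<and> face_of G b = x) \<and> (c \<in> W \<and> face_of G c = x))"
      by (intro once) blast
  qed (rule exposed_face[unfolded faces_def] primal_region_walks_eq)+
  have part4: "(\<forall>x. exposed_face G D x \<longrightarrow> primal_pure G D x \<longrightarrow>
        (\<forall>W\<in>dual_region_walks G D. passes_at_face_once G W x)) \<longleftrightarrow>
      (\<forall>b c. distinct_corners b c \<longrightarrow> c \<in> face_of H b \<longrightarrow> c \<in> vertex_of H b \<longrightarrow>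
        dual_flag b = False \<longrightarrow> bicoloured (vertex_of H b) \<longrightarrow> bicoloured (face_of H b))"
  proof (rule region_walks_once_iff[where X = "face_of G" and Y = "vertex_of G"])
    fix b c
    show "face_of G c = face_of G b \<longleftrightarrow> c \<in> face_of G b" by (rule orbit_eq_iff)
    show "face_of H c = face_of H b \<longleftrightarrow> c \<in> face_of H b" "vertex_of H c = vertex_of H b \<longleftrightarrow> c \<in> vertex_of H b"
      by (rule H.orbit_eq_iff)+
    assume b: "b \<in> flags G" "dual_flag b = False"
    show "bicoloured (face_of H b) \<longleftrightarrow> bicoloured (face_of G b)"
      "\<not> bicoloured (face_of H b) \<Longrightarrow> face_of H b = face_of G b"
      "bicoloured (vertex_of H b) \<longleftrightarrow> bicoloured (vertex_of G b)"
      using primal_flag_orbits[OF b(1)] b(2) by blast+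
  next
    fix x assume "x \<in> face_of G ` flags G"
    then show "primal_pure G D x \<longleftrightarrow> (\<forall>b\<in>x. dual_flag b = False)"
      by (intro pure_colour) (simp add: faces_def)
  next
    fix W x assume "W \<in> dual_region_walks G D"
    then show "passes_at_face_once G W x \<longleftrightarrow> \<not> (\<exists>b c. distinct_corners b c \<and>
        (b \<in> W \<and> face_of G b = x) \<and> (c \<in> W \<and> face_of G c = x))"
      by (intro once) blast
  qed (rule exposed_face[unfolded faces_def] dual_region_walks_eq)+
  have "MC G D \<longleftrightarrow>
      (\<forall>x. exposed_vertex G D x \<longrightarrow> primal_pure G D x \<longrightarrow>
        (\<forall>W\<in>primal_region_walks G D. passes_at_vertex_once G W x)) \<and>
      (\<forall>x. exposed_vertex G D x \<longrightarrow> dual_pure G D x \<longrightarrow>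
        (\<forall>W\<in>dual_region_walks G D. passes_at_vertex_once G W x)) \<and>
      (\<forall>x. exposed_face G D x \<longrightarrow> dual_pure G D x \<longrightarrow>
        (\<forall>W\<in>primal_region_walks G D. passes_at_face_once G W x)) \<and>
      (\<forall>x. exposed_face G D x \<longrightarrow> primal_pure G D x \<longrightarrow>
        (\<forall>W\<in>dual_region_walks G D. passes_at_face_once G W x))"
    unfolding MC_def by blast
  then show ?thesis
    unfolding part1 part2 part3 part4 by blast
qed

section \<open>Condition (GC)\<close>

lemma shared_edges_Zx:
  assumes h: "h \<in> {across H, along H}" "b \<in> flags G" and k: "k \<in> {across H, along H}" "d \<in> flags G"
  shows "shared_edges Zx (passage_flags G D h (trace_orbit h b)) (passage_flags G D k (trace_orbit k d)) =
    radial_edge ` {c \<in> trace_orbit h b \<inter> trace_orbit k d. at_mixed_corner c}"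
proof -
  \<comment> \<open>Equal radial edges mean equal corners, and traces are closed under
    \<open>turn\<close>, so intersecting the edge sets amounts to intersecting the traces.\<close>
  have "c \<in> trace_orbit k d"
    if c: "c \<in> trace_orbit h b" "c' \<in> trace_orbit k d" "radial_edge c = radial_edge c'" for c c'
  proof -
    have "c \<in> flags G" "c' \<in> flags G" using trace_orbit_closed(1)[OF h] trace_orbit_closed(1)[OF k] c by blast+
    then have "c' = c \<or> c = turn G c'"
      using c(3) radial_edge_eq_iff[of c' c] unfolding distinct_corners_def by metis
    then show ?thesis using c(2) trace_orbit_closed(2)[OF k] by blast
  qed
  then show ?thesis
    unfolding shared_edges_def incident_edges_Zx[OF h] incident_edges_Zx[OF k] by blast
qed

lemma zero_pure_corner_iff:
  assumes b: "b \<in> flags G"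
  shows "zero_pure_corner G D {b, turn G b} \<longleftrightarrow>
    \<not> at_mixed_corner b \<and> bicoloured (vertex_of H b) \<and> bicoloured (face_of H b)"
proof -
  have "{b, turn G b} \<in> corners G" using b unfolding corners_def by blast
  then show ?thesis
    unfolding zero_pure_corner_def bicoloured_H_orbits_iff(1)[OF b]
    using b by (simp add: corner_vertex_eq corner_face_eq mixed_orbit_iff mixed_corner_iff
        at_mixed_corner_def)
qed

text \<open>Edges shared by the faces of \<open>Zx\<close> given by a vertex and a face of the
  partial dual are their common mixed corners. When both orbits are bicoloured, the remaining common
  corners are 0-pure, so the clauses together cover every pair of common corners.\<close>

lemma GC_iff:
  "GC G D \<longleftrightarrow> (\<forall>b c. distinct_corners b c \<longrightarrow> c \<in> vertex_of H b \<longrightarrow> c \<in> face_of H b \<longrightarrow>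
     \<not> (bicoloured (vertex_of H b) \<and> bicoloured (face_of H b)))" (is "_ \<longleftrightarrow> ?R")
proof -
  let ?PV = "\<lambda>b. passage_flags G D (across H) (vertex_of H b)"
  let ?PF = "\<lambda>b. passage_flags G D (along H) (face_of H b)"
  have H_steps: "across H \<in> {across H, along H}" "along H \<in> {across H, along H}" by simp_all
  have shared: "shared_edges Zx (?PV b) (?PF b) =
      radial_edge ` {c \<in> vertex_of H b \<inter> face_of H b. at_mixed_corner c}" if "b \<in> flags G" for b
    using shared_edges_Zx[OF H_steps(1) that H_steps(2) that] unfolding trace_orbit_simps .
  \<comment> \<open>A mixed corner carries both colours and belongs to both orbits.\<close>
  have mixed_bicoloured: "bicoloured (vertex_of H b) \<and> bicoloured (face_of H b)"
    if "b \<in> flags G" "at_mixed_corner b" for b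
    using bicoloured_trace_orbit[OF H_steps(1) that(1)] bicoloured_trace_orbit[OF H_steps(2) that(1)]
      that(2) H.mem_own_orbit(1,2)[of b] unfolding trace_orbit_simps by blast
  show ?thesis
  proof
    assume GC: "GC G D"
    have faces: "\<not> card (shared_edges Zx F1 F2) \<ge> 2"
      if "F1 \<in> faces Zx" "F2 \<in> faces Zx" "F1 \<noteq> F2" for F1 F2
      using GC that unfolding GC_def Let_def by blast
    have zero: "shared_edges Zx (?PV b) (?PF b) = {}"
      "\<And>c. c \<in> flags G \<Longrightarrow> zero_pure_corner G D {c, turn G c} \<Longrightarrow> {c, turn G c} \<noteq> {b, turn G b} \<Longrightarrow>
        vertex_of H c = vertex_of H b \<Longrightarrow> face_of H c = face_of H b \<Longrightarrow> False"
      if b: "b \<in> flags G" "zero_pure_corner G D {b, turn G b}" for b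
    proof -
      have bi: "bicoloured (vertex_of H b)" "bicoloured (face_of H b)"
        using b zero_pure_corner_iff by blast+
      have *: "shared_edges Zx
          (petrie_face_of_vertex G D (corner_vertex H {b, turn G b}))
          (petrie_face_of_face G D (corner_face H {b, turn G b})) = {}"
        "\<not> (\<exists>y'. zero_pure_corner G D y' \<and> y' \<noteq> {b, turn G b} \<and>
          corner_vertex H y' = corner_vertex H {b, turn G b} \<and>
          corner_face H y' = corner_face H {b, turn G b})"
        using GC b(2) unfolding GC_def Let_def by blast+
      show "shared_edges Zx (?PV b) (?PF b) = {}"
        using *(1) b(1) bi by (simp add: H_corner_eq petrie_face_eq)
      show False if c: "c \<in> flags G" "zero_pure_corner G D {c, turn G c}"
        "{c, turn G c} \<noteq> {b, turn G b}" "vertex_of H c = vertex_of H b"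
        "face_of H c = face_of H b" for c
        using *(2) c H_corner_eq[OF c(1)] H_corner_eq[OF b(1)] by metis
    qed
    have pure_case: False
      if bc: "distinct_corners b c" "c \<in> vertex_of H b" "c \<in> face_of H b"
        "bicoloured (vertex_of H b)" "bicoloured (face_of H b)" "\<not> at_mixed_corner b" for b c
    proof -
      have flags: "b \<in> flags G" "c \<in> flags G" using bc(1) by (auto simp: distinct_corners_def)
      have b: "zero_pure_corner G D {b, turn G b}"
        using zero_pure_corner_iff[OF flags(1)] bc by blast
      have eq: "vertex_of H c = vertex_of H b" "face_of H c = face_of H b"
        using bc(2,3) by (simp_all add: H.orbit_eq_iff)
      show False
      proof (cases "at_mixed_corner c")
        case True
        then show False using zero(1)[OF flags(1) b] shared[OF flags(1)] bc(2,3) by blast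
      next
        case False
        then have "zero_pure_corner G D {c, turn G c}"
          using zero_pure_corner_iff[OF flags(2)] bc eq by simp
        moreover have "{c, turn G c} \<noteq> {b, turn G b}"
          using corner_eq_iff[OF flags] bc(1) by metis
        ultimately show False using zero(2)[OF flags(1) b flags(2)] eq by blast
      qed
    qed
    show ?R
    proof (intro allI impI notI)
      fix b c assume bc: "distinct_corners b c" "c \<in> vertex_of H b" "c \<in> face_of H b"
        "bicoloured (vertex_of H b) \<and> bicoloured (face_of H b)"
      have flags: "b \<in> flags G" "c \<in> flags G" using bc(1) by (auto simp: distinct_corners_def)
      have eq: "vertex_of H c = vertex_of H b" "face_of H c = face_of H b"
        using bc(2,3) by (simp_all add: H.orbit_eq_iff)
      have b: "at_mixed_corner b" using pure_case bc by blast
      \<comment> \<open>The situation is symmetric in the two corners, so only the case of two mixed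
        corners is left.\<close>
      have c: "at_mixed_corner c"
        using pure_case[OF distinct_corners_sym[OF bc(1)]] bc(4) eq H.mem_own_orbit(1,2)[of b]
        by metis
      \<comment> \<open>The vertex and the face may be equal as sets of flags; the ends still
        distinguish their passages.\<close>
      have "?PV b \<noteq> ?PF b"
      proof
        assume "?PV b = ?PF b"
        moreover have "(b, walk_end (across H) b) \<in> ?PV b"
          using mem_passage_flags_iff[OF H_steps(1) H_orbit_subset_flags(1)[OF flags(1)]] b by simp
        ultimately have "walk_end (across H) b = walk_end (along H) b"
          using mem_passage_flags_iff[OF H_steps(2) H_orbit_subset_flags(2)[OF flags(1)]] by simp
        then show False using walk_end_along_H[OF flags(1)] by (cases "walk_end (across H) b") auto
      qed
      moreover have "?PV b \<in> faces Zx" "?PF b \<in> faces Zx"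
        unfolding faces_Zx trace_orbit_simps[symmetric] using H_steps flags(1) b by blast+
      moreover have "card (shared_edges Zx (?PV b) (?PF b)) \<ge> 2"
      proof -
        have "finite (shared_edges Zx (?PV b) (?PF b))"
          unfolding shared[OF flags(1)]
          by (rule finite_imageI, rule finite_subset[OF _ finite_flags])
            (use H_orbit_subset_flags(1)[OF flags(1)] in blast)
        moreover have "{radial_edge b, radial_edge c} \<subseteq> shared_edges Zx (?PV b) (?PF b)"
          unfolding shared[OF flags(1)] using b c bc(2,3) by auto
        moreover have "card {radial_edge b, radial_edge c} = 2"
          using radial_edge_eq_iff[OF flags] bc(1) by simp
        ultimately show ?thesis by (metis card_mono)
      qed
      ultimately show False using faces by blast
    qed
  next
    assume R: ?R
    have "\<not> card (shared_edges Zx F1 F2) \<ge> 2"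
      if F: "F1 \<in> faces Zx" "F2 \<in> faces Zx" "F1 \<noteq> F2" for F1 F2
    proof
      assume card: "card (shared_edges Zx F1 F2) \<ge> 2"
      obtain h b where h: "h \<in> {across H, along H}" "b \<in> flags G"
        and F1: "F1 = passage_flags G D h (trace_orbit h b)" using F(1) unfolding faces_Zx by blast
      obtain k d where k: "k \<in> {across H, along H}" "d \<in> flags G"
        and F2: "F2 = passage_flags G D k (trace_orbit k d)" using F(2) unfolding faces_Zx by blast
      have sh: "shared_edges Zx F1 F2 =
          radial_edge ` {c \<in> trace_orbit h b \<inter> trace_orbit k d. at_mixed_corner c}"
        unfolding F1 F2 using shared_edges_Zx[OF h k] .
      have "\<not> is_singleton (shared_edges Zx F1 F2)" "shared_edges Zx F1 F2 \<noteq> {}"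
        using card by (auto simp: is_singleton_altdef)
      then obtain e e' where "e \<in> shared_edges Zx F1 F2" "e' \<in> shared_edges Zx F1 F2" "e \<noteq> e'"
        by (metis is_singletonI' ex_in_conv)
      then obtain c c' where c: "c \<in> trace_orbit h b" "c \<in> trace_orbit k d" "at_mixed_corner c"
        and c': "c' \<in> trace_orbit h b" "c' \<in> trace_orbit k d" "radial_edge c \<noteq> radial_edge c'"
        unfolding sh by blast
      have flags: "c \<in> flags G" "c' \<in> flags G"
        using trace_orbit_closed(1)[OF h] c(1) c'(1) by blast+
      have orbits: "trace_orbit h c = trace_orbit h b" "trace_orbit k c = trace_orbit k d"
        using trace_orbit_eq_iff h(1) k(1) c by blast+
      \<comment> \<open>Traces with the same step map that meet are equal, so different faces
        sharing an edge come from one vertex and one face.\<close>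
      then have "h \<noteq> k" using F(3) F1 F2 by auto
      then have "c' \<in> trace_orbit (across H) c" "c' \<in> trace_orbit (along H) c"
        using h(1) k(1) c' orbits by auto
      then have "c' \<in> vertex_of H c" "c' \<in> face_of H c" unfolding trace_orbit_simps .
      moreover have "distinct_corners c c'" using radial_edge_eq_iff[OF flags] c'(3) by blast
      ultimately show False using R mixed_bicoloured[OF flags(1) c(3)] by blast
    qed
    moreover have "shared_edges Zx (petrie_face_of_vertex G D (corner_vertex H y))
          (petrie_face_of_face G D (corner_face H y)) = {} \<and>
        \<not> (\<exists>y'. zero_pure_corner G D y' \<and> y' \<noteq> y \<and>
          corner_vertex H y' = corner_vertex H y \<and> corner_face H y' = corner_face H y)"
      if y: "zero_pure_corner G D y" for y
    proof -
      obtain b where b: "b \<in> flags G" "y = {b, turn G b}"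
        using y by (auto simp: zero_pure_corner_def corners_def)
      have pure: "\<not> at_mixed_corner b" "bicoloured (vertex_of H b)" "bicoloured (face_of H b)"
        using y zero_pure_corner_iff[OF b(1)] b(2) by auto
      have only: False if "distinct_corners b c" "c \<in> vertex_of H b" "c \<in> face_of H b" for c
        using R that pure by blast
      have "{c \<in> vertex_of H b \<inter> face_of H b. at_mixed_corner c} = {}"
      proof (rule ccontr)
        assume "{c \<in> vertex_of H b \<inter> face_of H b. at_mixed_corner c} \<noteq> {}"
        then obtain c where c: "c \<in> vertex_of H b" "c \<in> face_of H b" "at_mixed_corner c" by blast
        then have "c \<in> flags G" using H_orbit_subset_flags(1)[OF b(1)] by blast
        then have "distinct_corners b c"
          using b(1) c(3) pure(1) at_mixed_corner_turn[OF b(1)] by (auto simp: distinct_corners_def)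
        then show False using only c by blast
      qed
      then have "shared_edges Zx (?PV b) (?PF b) = {}" unfolding shared[OF b(1)] by simp
      moreover have "petrie_face_of_vertex G D (corner_vertex H y) = ?PV b"
        "petrie_face_of_face G D (corner_face H y) = ?PF b"
        using b pure by (simp_all add: H_corner_eq petrie_face_eq)
      moreover have False if y': "zero_pure_corner G D y'" "y' \<noteq> y"
        "corner_vertex H y' = corner_vertex H y" "corner_face H y' = corner_face H y" for y'
      proof -
        obtain c where c: "c \<in> flags G" "y' = {c, turn G c}"
          using y'(1) by (auto simp: zero_pure_corner_def corners_def)
        have "c \<in> vertex_of H b" "c \<in> face_of H b"
          using y'(3,4) b c by (simp_all add: H_corner_eq H.orbit_eq_iff)
        moreover have "distinct_corners b c"
          using corner_eq_iff[OF b(1) c(1)] y'(2) b(2) c(2) by metis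
        ultimately show False using only by blast
      qed
      ultimately show ?thesis by metis
    qed
    ultimately show "GC G D" unfolding GC_def Let_def by blast
  qed
qed

text \<open>In the exceptional configuration the four flags of one edge are closed under
  \<open>turn\<close>, hence under all three maps of \<open>G\<close>. Connectedness makes them all
  flags, leaving a single edge.\<close>

lemma closed_2_cell_H_iff:
  assumes conn: "\<And>b. b \<in> flags G \<Longrightarrow> flag_orbit (flags G) {along G, turn G, across G} b = flags G"
    and two: "card (edges G) \<ge> 2"
  shows "closed_2_cell H \<longleftrightarrow>
    (\<forall>b c. distinct_corners b c \<longrightarrow> c \<in> vertex_of H b \<longrightarrow> c \<notin> face_of H b)"
proof -
  have "\<not> (turn G c = across H c \<and> turn G (along H c) = across H (along H c))"
    if c: "c \<in> flags G" for c
  proof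
    assume turn: "turn G c = across H c \<and> turn G (along H c) = across H (along H c)"
    \<comment> \<open>Exchanging \<open>along\<close> and \<open>across\<close> on an edge leaves
      its set of four flags unchanged.\<close>
    have edge: "edge_of G c = {c, along H c, across H c, across H (along H c)}"
        unfolding edge_of_eq[OF c] using c along_across[OF c]
      by (cases "dual_flag c") (simp_all add: H_along H_across insert_commute)
    have turn_edge: "turn G d \<in> edge_of G c" if "d \<in> edge_of G c" for d
    proof -
      have "turn G (across H c) = c" "turn G (across H (along H c)) = along H c"
        using turn c v.t_simps(3)[of c] v.t_simps(3)[of "along H c"] H.f.h_simps(1)[of c] by simp_all
      moreover have "d = c \<or> d = along H c \<or> d = across H c \<or> d = across H (along H c)"
        using that unfolding edge by blast
      ultimately have "turn G d \<in> {c, along H c, across H c, across H (along H c)}"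
        using turn by (elim disjE) simp_all
      then show ?thesis unfolding edge .
    qed
    have "flag_orbit (flags G) {along G, turn G, across G} c \<subseteq> edge_of G c"
    proof (rule flag_orbit_subset)
      fix d h assume d: "d \<in> edge_of G c" "d \<in> flags G" "h \<in> {along G, turn G, across G}"
      have "edge_of G d = edge_of G c" using d(1) unfolding orbit_eq_iff .
      then have "along G d \<in> edge_of G c" "across G d \<in> edge_of G c"
        using orbit_invariant(5,6)[OF d(2)] unfolding orbit_eq_iff(3)[symmetric] by simp_all
      then show "h d \<in> edge_of G c" using turn_edge[OF d(1)] d(3) by blast
    qed simp
    then have "edge_of G b = edge_of G c" if "b \<in> flags G" for b
      using that conn[OF c] unfolding orbit_eq_iff by blast
    then have "edges G \<subseteq> {edge_of G c}" unfolding edges_def by blast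
    then have "card (edges G) \<le> card {edge_of G c}" by (intro card_mono) simp_all
    then show False using two by simp
  qed
  then show ?thesis using H.closed_2_cell_iff by simp
qed

end

theorem theorem3p4:
  fixes G :: "'a embedding" and D :: "'a set set"
  assumes "is_embedding G"
    and "card (edges G) \<ge> 2"
    and "D \<subseteq> edges G"
  shows "closed_2_cell (partial_dual G D) \<longleftrightarrow> LC G D \<and> MC G D \<and> GC G D"
proof -
  interpret flag_system G by (rule is_embedding_flag_system) fact
  interpret partial_duality G D by unfold_locales fact
  have "closed_2_cell (partial_dual G D) \<longleftrightarrow>
      (\<forall>b c. distinct_corners b c \<longrightarrow> c \<in> vertex_of H b \<longrightarrow> c \<notin> face_of H b)"
    by (rule closed_2_cell_H_iff) (use assms(1,2) in \<open>auto simp: is_embedding_def\<close>)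
  then show ?thesis
    unfolding LC_iff MC_iff GC_iff by blast
qed

end
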